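(* Let $\mathbb{G}=(A,\Delta)$ be a compact quantum group, let $\phi$ be an idempotent state on $\mathbb{G}$, and let $u\in A^*$ be $\phi$-bi-invariant. Then the following are equivalent: (1) $u(1)=0$ and $u$ is conditionally positive definite with respect to $\phi$, i.e. $u(x^*x)\ge 0$ for all $x\in A$ with $\phi(x^*x)=0$; (2) $u=r(v-\phi)$ for some real $r\ge0$ and some $\phi$-bi-invariant state $v$ on $A$.
   Context: A compact quantum group $\mathbb{G}=(A,\Delta)$ consists of a unital C*-algebra $A$ and a unital *-homomorphism $\Delta:A\to A\otimes A$ (minimal tensor product) with $(\Delta\otimes\iota)\Delta=(\iota\otimes\Delta)\Delta$ and such that $\{\Delta(a)(1\otimes b)\}$ and $\{\Delta(a)(b\otimes 1)\}$ are linearly dense in $A\otimes A$. For $\varphi_1,\varphi_2\in A^*$ the convolution is $\varphi_1\varphi_2:=(\varphi_1\otimes\varphi_2)\Delta$. A state $\phi$ is idempotent if $\phi\phi=\phi$. A functional $u\in A^*$ is $\phi$-bi-invariant if $u\phi=\phi u=u$. *)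

theory Defs
  imports "HOL-Analysis.Analysis"
begin

text \<open>A unital C*-algebra: a unital real Banach algebra with a central embedding
  ofc of the complex numbers (giving the complex vector space structure
  c . a = ofc c * a) and an involution adj satisfying the C*-identity.\<close>

class cstar = real_normed_algebra_1 + banach +
  fixes ofc :: "complex \<Rightarrow> 'a"
    and adj :: "'a \<Rightarrow> 'a"
  assumes ofc_add: "ofc (c + d) = ofc c + ofc d"
    and ofc_mult: "ofc (c * d) = ofc c * ofc d"
    and ofc_of_real: "ofc (complex_of_real r) = r *\<^sub>R 1"
    and ofc_central: "ofc c * x = x * ofc c"
    and norm_ofc: "norm (ofc c * x) = cmod c * norm x"
    and adj_adj: "adj (adj x) = x"
    and adj_add: "adj (x + y) = adj x + adj y"
    and adj_mult: "adj (x * y) = adj y * adj x"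
    and adj_ofc: "adj (ofc c * x) = ofc (cnj c) * adj x"
    and cstar_identity: "norm (adj x * x) = (norm x)\<^sup>2"

definition cfunctional :: "('a::cstar \<Rightarrow> complex) \<Rightarrow> bool" where
  "cfunctional f \<longleftrightarrow>
     (\<forall>a b. f (a + b) = f a + f b) \<and>
     (\<forall>c a. f (ofc c * a) = c * f a) \<and>
     (\<exists>K. \<forall>a. cmod (f a) \<le> K * norm a)"

definition cnonneg :: "complex \<Rightarrow> bool" where
  "cnonneg z \<longleftrightarrow> Im z = 0 \<and> 0 \<le> Re z"

definition state :: "('a::cstar \<Rightarrow> complex) \<Rightarrow> bool" where
  "state f \<longleftrightarrow> cfunctional f \<and> f 1 = 1 \<and> (\<forall>x. cnonneg (f (adj x * x)))"

definition star_hom :: "('a::cstar \<Rightarrow> 'b::cstar) \<Rightarrow> bool" where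
  "star_hom D \<longleftrightarrow>
     (\<forall>a b. D (a + b) = D a + D b) \<and> (\<forall>c a. D (ofc c * a) = ofc c * D a) \<and>
     (\<forall>a b. D (a * b) = D a * D b) \<and> (\<forall>a. D (adj a) = adj (D a)) \<and> D 1 = 1"

definition prodfun :: "('a::cstar \<Rightarrow> 'b::cstar \<Rightarrow> 'c::cstar) \<Rightarrow> ('a \<Rightarrow> complex)
    \<Rightarrow> ('b \<Rightarrow> complex) \<Rightarrow> ('c \<Rightarrow> complex) \<Rightarrow> bool" where
  "prodfun T f g h \<longleftrightarrow> cfunctional h \<and> (\<forall>a b. h (T a b) = f a * g b)"

text \<open>T (a, b) = a (x) b exhibits 'c as the minimal C*-tensor product of 'a and 'b:
  T is bilinear and multiplicative, compatible with the involution, has dense span,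
  product functionals exist, and the norm is the spatial norm, i.e. the supremum of
  the norms in the GNS representations of product states.\<close>
definition min_tensor :: "('a::cstar \<Rightarrow> 'b::cstar \<Rightarrow> 'c::cstar) \<Rightarrow> bool" where
  "min_tensor T \<longleftrightarrow>
     (\<forall>a a' b. T (a + a') b = T a b + T a' b) \<and>
     (\<forall>a b b'. T a (b + b') = T a b + T a b') \<and>
     (\<forall>c a b. T (ofc c * a) b = ofc c * T a b) \<and>
     (\<forall>c a b. T a (ofc c * b) = ofc c * T a b) \<and>
     (\<forall>a a' b b'. T (a * a') (b * b') = T a b * T a' b') \<and>
     (\<forall>a b. adj (T a b) = T (adj a) (adj b)) \<and>
     T 1 1 = 1 \<and>
     closure (span (range (case_prod T))) = UNIV \<and>
     (\<forall>f g. cfunctional f \<and> cfunctional g \<longrightarrow> (\<exists>h. prodfun T f g h)) \<and>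
     (\<forall>x. (norm x)\<^sup>2 = Sup {Re (h (adj y * adj x * x * y)) | f g h y.
            state f \<and> state g \<and> prodfun T f g h \<and> h (adj y * y) = 1})"

text \<open>T : A x A -> A (x) A (type 'b), Delta : A -> A (x) A, and two models
  m1 : (A (x) A) x A -> A(x)A(x)A, m2 : A x (A (x) A) -> A(x)A(x)A of the triple tensor
  product (type 'c), identified via a(x)b(x)c.  D1 = Delta (x) id and D2 = id (x) Delta.\<close>
definition compact_quantum_group ::
  "('a::cstar \<Rightarrow> 'a \<Rightarrow> 'b::cstar) \<Rightarrow> ('a \<Rightarrow> 'b) \<Rightarrow> ('b \<Rightarrow> 'a \<Rightarrow> 'c::cstar) \<Rightarrow> ('a \<Rightarrow> 'b \<Rightarrow> 'c) \<Rightarrow> bool"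
  where
  "compact_quantum_group T Delta m1 m2 \<longleftrightarrow>
     min_tensor T \<and> min_tensor m1 \<and> min_tensor m2 \<and>
     (\<forall>a b c. m1 (T a b) c = m2 a (T b c)) \<and>
     star_hom Delta \<and>
     (\<exists>D1 D2. star_hom D1 \<and> star_hom D2 \<and> continuous_on UNIV D1 \<and> continuous_on UNIV D2 \<and>
        (\<forall>a b. D1 (T a b) = m1 (Delta a) b) \<and> (\<forall>a b. D2 (T a b) = m2 a (Delta b)) \<and>
        (\<forall>a. D1 (Delta a) = D2 (Delta a))) \<and>
     closure (span {Delta a * T 1 b | a b. True}) = UNIV \<and>
     closure (span {Delta a * T b 1 | a b. True}) = UNIV"

definition conv :: "('a::cstar \<Rightarrow> 'a \<Rightarrow> 'b::cstar) \<Rightarrow> ('a \<Rightarrow> 'b)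
    \<Rightarrow> ('a \<Rightarrow> complex) \<Rightarrow> ('a \<Rightarrow> complex) \<Rightarrow> ('a \<Rightarrow> complex)" where
  "conv T Delta f g = (\<lambda>a. (THE h. prodfun T f g h) (Delta a))"

end

theory Submission
  imports Defs
begin

text \<open>Let \<open>R = (\<iota> \<otimes> \<phi>)\<Delta>\<close>. Since \<open>\<phi>\<close> is idempotent, \<open>R\<close> is a conditional expectation onto a
  C*-subalgebra \<open>B\<close>, and an argument in the manner of Woronowicz's uniqueness proof for the Haar
  state shows that \<open>\<phi>\<close> restricts to a character of \<open>B\<close>. As \<open>u \<circ> R = u\<close>, a lower bound
  \<open>u \<ge> - r \<phi>\<close> need only be shown on positive \<open>w \<in> B\<close> with \<open>\<phi> w = 1\<close>. There
  \<open>y = (w - 1) (w + 1)\<^sup>-\<^sup>1 \<in> B\<close> is selfadjoint, bounded independently of \<open>w\<close> and annihilated by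
  \<open>\<phi>\<close>, and \<open>w - 1 = y w y + y\<^sup>2 + 2 y\<close>. Conditional positivity makes \<open>u\<close> nonnegative on
  \<open>y w y + y\<^sup>2\<close>, hence \<open>u w \<ge> - 2 \<parallel>u\<parallel> \<parallel>y\<parallel>\<close>. Then \<open>v = u / r + \<phi>\<close> is the required state.

  The slice map \<open>\<iota> \<otimes> \<phi>\<close> is constructed from the product functionals by the Hahn--Banach
  theorem (uniqueness) and the uniform boundedness principle (continuity).\<close>

section \<open>Elementary facts on scalars and the involution\<close>

text \<open>Cancels a factor in estimates of a quantity by itself, the form in which the C*-identity
  yields norm bounds below.\<close>

lemma le_if_square_le_mult: "x \<le> c" if "x\<^sup>2 \<le> c * x" "0 \<le> c" for x c :: real
proof (cases "x \<le> 0")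
  case False
  with that show ?thesis by (simp add: power2_eq_square)
qed (use that in auto)

lemma ofc_0 [simp]: "ofc 0 = 0"
  using ofc_of_real[of 0] by simp

lemma ofc_1 [simp]: "ofc 1 = 1"
  using ofc_of_real[of 1] by simp

lemma scaleR_ofc: "r *\<^sub>R x = ofc (complex_of_real r) * (x::'a::cstar)"
  by (simp add: ofc_of_real)

lemma ofc_minus: "ofc (- c) = - ofc c"
  using ofc_add[of c "- c"] by (simp add: add_eq_0_iff)

lemma mult_ofc: "(x::'a::cstar) * (ofc c * y) = ofc c * (x * y)"
  by (metis ofc_central mult.assoc)

lemma ofc_mult_ofc_mult: "(ofc c * x) * (ofc d * y) = ofc (c * d) * ((x::'a::cstar) * y)"
  by (metis mult.assoc mult_ofc ofc_mult)

lemma adj_0 [simp]: "adj 0 = (0::'a::cstar)"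
  using adj_add[of "0::'a" 0] by simp

lemma adj_1 [simp]: "adj 1 = (1::'a::cstar)"
  by (metis adj_adj adj_mult mult_1 mult.right_neutral)

lemma adj_scaleR: "adj (r *\<^sub>R x) = r *\<^sub>R adj (x::'a::cstar)"
  by (simp add: scaleR_ofc adj_ofc)

text \<open>Cancelling \<open>norm y\<close> in the C*-identity gives one inequality; passing to the
  adjoint gives the other.\<close>

lemma norm_adj [simp]: "norm (adj x) = norm (x::'a::cstar)"
proof -
  have *: "norm y \<le> norm (adj y)" for y :: 'a
  proof (cases "y = 0")
    case False
    have "(norm y)\<^sup>2 \<le> norm (adj y) * norm y"
      unfolding cstar_identity[symmetric] by (rule norm_mult_ineq)
    then show ?thesis by (rule le_if_square_le_mult) simp
  qed simp
  show ?thesis using *[of x] *[of "adj x"] by (simp add: adj_adj)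
qed

lemma bounded_linear_adj: "bounded_linear (adj :: 'a::cstar \<Rightarrow> 'a)"
  by (rule bounded_linear_intro[where K = 1]) (auto simp: adj_add adj_scaleR)

lemma adj_diff: "adj (x - y) = adj x - adj (y::'a::cstar)"
  using bounded_linear_adj by (rule linear_diff[OF bounded_linear.linear])

subsection \<open>Functionals\<close>

lemma cfunctional_intro:
  assumes "\<And>a b. f (a + b) = f a + f b" "\<And>c a. f (ofc c * a) = c * f a"
    "\<And>a. cmod (f a) \<le> K * norm a"
  shows "cfunctional f"
  using assms by (auto simp: cfunctional_def)

lemma cfunctional_bounded_linear: "cfunctional f \<Longrightarrow> bounded_linear f"
proof -
  assume f: "cfunctional f"
  then obtain K where "\<And>a. cmod (f a) \<le> K * norm a"
    by (auto simp: cfunctional_def)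
  with f show ?thesis
    by (intro bounded_linear_intro[where K = K])
      (auto simp: cfunctional_def scaleR_ofc scaleR_conv_of_real mult.commute simp del: of_real_mult)
qed

lemma
  assumes "cfunctional f"
  shows cfunctional_add: "f (a + b) = f a + f b"
    and cfunctional_ofc: "f (ofc c * a) = c * f a"
    and cfunctional_ofc_1: "f (ofc c) = c * f 1"
    and cfunctional_scaleR: "f (r *\<^sub>R a) = complex_of_real r * f a"
    and cfunctional_diff: "f (a - b) = f a - f b"
    and cfunctional_minus: "f (- b) = - f b"
    and cfunctional_0: "f 0 = 0"
    and cfunctional_sum: "f (\<Sum>i\<in>I. h i) = (\<Sum>i\<in>I. f (h i))"
    and cfunctional_continuous: "continuous_on S f"
proof -
  interpret bounded_linear f using assms by (rule cfunctional_bounded_linear)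
  show "f (a + b) = f a + f b" "f (ofc c * a) = c * f a"
    using assms by (auto simp: cfunctional_def)
  then show "f (ofc c) = c * f 1"
    using assms by (metis cfunctional_def mult.right_neutral)
  show "f (r *\<^sub>R a) = complex_of_real r * f a"
    using scaleR[of r a] unfolding scaleR_conv_of_real[of r "f a"] .
  show "f (a - b) = f a - f b" "f (- b) = - f b" "f 0 = 0" "f (\<Sum>i\<in>I. h i) = (\<Sum>i\<in>I. f (h i))"
    by (simp_all add: scaleR diff neg zero sum)
  show "continuous_on S f" by (simp add: linear_continuous_on bounded_linear_axioms)
qed

lemmas cfunctional_simps =
  cfunctional_add cfunctional_ofc cfunctional_ofc_1 cfunctional_scaleR cfunctional_diff
  cfunctional_minus cfunctional_0

lemma cfunctional_comp_bounded_linear: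
  assumes "cfunctional f" "bounded_linear L" "\<And>c a. L (ofc c * a) = ofc c * L a"
  shows "cfunctional (\<lambda>a. f (L a))"
proof -
  have "bounded_linear (\<lambda>a. f (L a))"
    using cfunctional_bounded_linear[OF assms(1)] assms(2) by (rule bounded_linear_compose)
  then obtain K where "\<And>a. norm (f (L a)) \<le> norm a * K"
    using bounded_linear.bounded by blast
  moreover have "L (a + b) = L a + L b" for a b
    using assms(2) by (simp add: linear_add bounded_linear.linear)
  ultimately show ?thesis using assms(1,3)
    by (intro cfunctional_intro[where K = K]) (simp_all add: cfunctional_simps[OF assms(1)] mult.commute)
qed

lemma cfunctional_lincomb:
  assumes "cfunctional f" "cfunctional g"
  shows "cfunctional (\<lambda>a. c * f a + d * g a)"
proof -
  have "bounded_linear (\<lambda>a. c * f a + d * g a)"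
    using assms
    by (intro bounded_linear_add bounded_linear_const_mult cfunctional_bounded_linear)
  then obtain K where "\<And>a. norm (c * f a + d * g a) \<le> norm a * K"
    using bounded_linear.bounded by blast
  with assms show ?thesis
    by (intro cfunctional_intro[where K = K])
      (simp_all add: assms[THEN cfunctional_add] assms[THEN cfunctional_ofc] algebra_simps)
qed

lemma cfunctional_mult_left: "cfunctional f \<Longrightarrow> cfunctional (\<lambda>a. f (c * a))"
  by (rule cfunctional_comp_bounded_linear) (auto simp: mult_ofc bounded_linear_mult_right)

lemma cfunctional_mult_right: "cfunctional f \<Longrightarrow> cfunctional (\<lambda>a. f (a * c))"
  by (rule cfunctional_comp_bounded_linear) (auto simp: mult.assoc bounded_linear_mult_left)

subsection \<open>Positive functionals\<close>

lemma cnonneg_iff: "cnonneg z \<longleftrightarrow> z = of_real (Re z) \<and> 0 \<le> Re z"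
  by (auto simp: cnonneg_def complex_eq_iff)

lemma cnonneg_add: "cnonneg z \<Longrightarrow> cnonneg w \<Longrightarrow> cnonneg (z + w)"
  by (auto simp: cnonneg_def)

lemma cnonneg_scale: "0 \<le> r \<Longrightarrow> cnonneg z \<Longrightarrow> cnonneg (complex_of_real r * z)"
  by (auto simp: cnonneg_def)

lemma closed_cnonneg: "closed {z. cnonneg z}"
  unfolding cnonneg_def
  by (intro closed_Collect_conj closed_Collect_eq closed_Collect_le continuous_intros)

definition positive_functional :: "('a::cstar \<Rightarrow> complex) \<Rightarrow> bool" where
  "positive_functional f \<longleftrightarrow> cfunctional f \<and> (\<forall>x. cnonneg (f (adj x * x)))"

lemma state_iff: "state f \<longleftrightarrow> positive_functional f \<and> f 1 = 1"
  by (auto simp: state_def positive_functional_def)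

lemma cfunctional_sesquilinear:
  assumes f: "cfunctional f"
  shows "f (adj (ofc c * x + ofc d * y) * (ofc c * x + ofc d * y)) =
     cnj c * c * f (adj x * x) + cnj d * d * f (adj y * y)
       + cnj c * d * f (adj x * y) + cnj d * c * f (adj y * x)"
  unfolding adj_add adj_ofc distrib_left distrib_right ofc_mult_ofc_mult
    cfunctional_add[OF f] cfunctional_ofc[OF f] by simp

text \<open>Expands a Gram--Schmidt step, in which both arguments are shifted by multiples of one
  vector \<open>z\<close>.\<close>

lemma cfunctional_sesquilinear_shift:
  assumes f: "cfunctional f"
  shows "f (adj (x + ofc c * z) * (y + ofc d * z)) =
     f (adj x * y) + d * f (adj x * z) + cnj c * f (adj z * y) + cnj c * d * f (adj z * z)"
proof -
  have "adj (x + ofc c * z) * (y + ofc d * z) =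
     adj x * y + ofc d * (adj x * z) + ofc (cnj c) * (adj z * y) + ofc (cnj c * d) * (adj z * z)"
    using ofc_mult_ofc_mult[of "cnj c" "adj z" d z] mult_ofc[of "adj x" d z]
    by (simp add: adj_add adj_ofc distrib_left distrib_right mult.assoc add_ac)
  then show ?thesis by (simp add: cfunctional_add[OF f] cfunctional_ofc[OF f])
qed

text \<open>The coefficients (1,1) and (1,i) compare imaginary and real parts of the mixed terms.
  Realness is asked on the span of \<open>x\<close> and \<open>y\<close> only, because conditional
  positivity gives it for null vectors only.\<close>

lemma hermitian_on_polarization:
  assumes f: "cfunctional f"
    and nn: "\<And>c d. Im (f (adj (ofc c * x + ofc d * y) * (ofc c * x + ofc d * y))) = 0"
  shows "f (adj y * x) = cnj (f (adj x * y))"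
proof -
  from nn[of 1 0] nn[of 0 1] nn[of 1 1] nn[of 1 \<i>] show ?thesis
    unfolding cfunctional_sesquilinear[OF f] by (simp add: complex_eq_iff)
qed

context
  fixes f :: "'a::cstar \<Rightarrow> complex"
  assumes pf: "positive_functional f"
begin

lemma posf_c: "cfunctional f" and posf_nn: "cnonneg (f (adj x * x))"
  using pf by (auto simp: positive_functional_def)

lemma posf_hermitian2: "f (adj y * x) = cnj (f (adj x * y))"
  using posf_c posf_nn by (intro hermitian_on_polarization) (auto simp: cnonneg_def)

lemma posf_adj: "f (adj x) = cnj (f x)"
  using posf_hermitian2[of x 1] by simp

lemma posf_1_nonneg: "0 \<le> Re (f 1)"
  using posf_nn[of 1] by (auto simp: cnonneg_iff)

lemma posf_CS: "(cmod (f (adj x * y)))\<^sup>2 \<le> Re (f (adj x * x)) * Re (f (adj y * y))"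
proof -
  define p q z where "p = Re (f (adj x * x))" and "q = Re (f (adj y * y))"
    and "z = f (adj x * y)"
  have p: "f (adj x * x) = of_real p" "0 \<le> p" and q: "f (adj y * y) = of_real q" "0 \<le> q"
    using posf_nn[of x] posf_nn[of y] by (auto simp: p_def q_def cnonneg_iff)
  \<comment> \<open>Positivity at \<open>y - r z x\<close>: the factor \<open>z\<close> makes both
    cross terms equal to \<open>- r * (cmod z)\<^sup>2\<close>.\<close>
  have main: "0 \<le> r\<^sup>2 * (cmod z)\<^sup>2 * p + q - 2 * r * (cmod z)\<^sup>2" for r
  proof -
    let ?c = "- (complex_of_real r * z)"
    have "f (adj (ofc ?c * x + y) * (ofc ?c * x + y)) =
      cnj ?c * ?c * f (adj x * x) + f (adj y * y) + cnj ?c * f (adj x * y) + ?c * f (adj y * x)"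
      using cfunctional_sesquilinear[OF posf_c, of ?c x 1 y] by simp
    also have "\<dots> = of_real (r\<^sup>2 * (cmod z)\<^sup>2 * p + q - 2 * r * (cmod z)\<^sup>2)"
      unfolding posf_hermitian2[of y x] p q z_def[symmetric]
      by (simp add: complex_eq_iff cmod_power2) (auto simp: algebra_simps power2_eq_square)
    finally show ?thesis using posf_nn[of "ofc ?c * x + y"] by (simp add: cnonneg_def)
  qed
  have "(cmod z)\<^sup>2 \<le> p * q"
  proof (cases "z = 0")
    case True
    then show ?thesis using p q by simp
  next
    case False
    show ?thesis
    proof (cases "p = 0")
      case True
      \<comment> \<open>With \<open>p = 0\<close> the bound is affine in \<open>r\<close>; this
        choice makes its right-hand side -1.\<close>
      define r where "r = (q + 1) / (2 * (cmod z)\<^sup>2)"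
      have "2 * r * (cmod z)\<^sup>2 = q + 1" using False by (simp add: r_def)
      then show ?thesis using main[of r] True by simp
    next
      case pn: False
      \<comment> \<open>\<open>r = 1 / p\<close> minimises the quadratic.\<close>
      then show ?thesis using main[of "1/p"] p by (simp add: field_simps power2_eq_square)
    qed
  qed
  then show ?thesis by (simp add: p_def q_def z_def)
qed

lemma posf_null:
  assumes "f (adj x * x) = 0"
  shows "f (y * x) = 0"
  using posf_CS[of "adj y" x] assms by (simp add: adj_adj)

text \<open>Cauchy--Schwarz against the unit gives \<open>|f a|\<^sup>2 \<le> f 1 \<cdot> \<parallel>f\<parallel> \<cdot> \<parallel>a\<parallel>\<^sup>2\<close>; hence \<open>\<parallel>f\<parallel>\<^sup>2 \<le> f 1 \<cdot> \<parallel>f\<parallel>\<close>.\<close>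
lemma posf_bound: "cmod (f a) \<le> Re (f 1) * norm a"
proof -
  have bl: "bounded_linear f" using posf_c by (rule cfunctional_bounded_linear)
  have "cmod (f a) \<le> sqrt (Re (f 1) * onorm f) * norm a" for a
  proof (rule power2_le_imp_le)
    have "(cmod (f a))\<^sup>2 \<le> Re (f 1) * Re (f (adj a * a))"
      using posf_CS[of 1 a] by simp
    also have "\<dots> \<le> Re (f 1) * (onorm f * norm (adj a * a))"
      using onorm[OF bl, of "adj a * a"] posf_1_nonneg
      by (intro mult_left_mono order_trans[OF complex_Re_le_cmod])
    finally show "(cmod (f a))\<^sup>2 \<le> (sqrt (Re (f 1) * onorm f) * norm a)\<^sup>2"
      using posf_1_nonneg onorm_pos_le[OF bl] by (simp add: power_mult_distrib cstar_identity)
  qed (use posf_1_nonneg onorm_pos_le[OF bl] in simp)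
  then have "onorm f \<le> sqrt (Re (f 1) * onorm f)"
    using posf_1_nonneg onorm_pos_le[OF bl] by (intro onorm_bound) auto
  then have "(onorm f)\<^sup>2 \<le> Re (f 1) * onorm f"
    using posf_1_nonneg onorm_pos_le[OF bl] real_sqrt_le_iff[of "(onorm f)\<^sup>2"] by simp
  then have "onorm f \<le> Re (f 1)" by (rule le_if_square_le_mult) (rule posf_1_nonneg)
  then show ?thesis
    using onorm[OF bl, of a] by (meson mult_right_mono norm_ge_zero order_trans)
qed

text \<open>These are the vector functionals of the GNS representation, which lets the spatial norm
  be handled without constructing representations.\<close>

lemma posf_compress: "positive_functional (\<lambda>a. f (adj d * a * d))"
  unfolding positive_functional_def
proof (intro conjI allI)
  show "cfunctional (\<lambda>a. f (adj d * a * d))"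
    using cfunctional_mult_left[OF cfunctional_mult_right[OF posf_c, of d], of "adj d"]
    by (simp add: mult.assoc)
  show "cnonneg (f (adj d * (adj x * x) * d))" for x
    using posf_nn[of "x * d"] by (simp add: adj_mult mult.assoc)
qed

end

subsection \<open>Tensor products\<close>

context
  fixes T :: "'a::cstar \<Rightarrow> 'b::cstar \<Rightarrow> 'c::cstar"
  assumes mt: "min_tensor T"
begin

lemma
  shows tensor_add_left: "T (a + a') b = T a b + T a' b"
    and tensor_ofc_left: "T (ofc k * a) b = ofc k * T a b"
    and tensor_mult: "T (a * a') (b * b') = T a b * T a' b'"
    and tensor_adj: "adj (T a b) = T (adj a) (adj b)"
    and tensor_1_1: "T 1 1 = 1"
    and tensor_dense: "closure (span (range (case_prod T))) = UNIV"
    and tensor_prodfun_ex: "cfunctional f \<Longrightarrow> cfunctional g \<Longrightarrow> \<exists>h. prodfun T f g h"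
    and tensor_norm: "(norm x)\<^sup>2 = Sup {Re (h (adj y * adj x * x * y)) | f g h y.
            state f \<and> state g \<and> prodfun T f g h \<and> h (adj y * y) = 1}"
  using mt unfolding min_tensor_def by ((elim conjE, blast | elim conjE, simp only:)+)

lemma tensor_left_mult: "T (a * a') b = T a 1 * T a' b"
  using tensor_mult[of a a' 1 b] by simp

text \<open>Real scalars are absorbed into the first leg of an elementary tensor, so sums and limits
  suffice.\<close>

lemma dense_induct [case_names closed add tensor]:
  assumes "closed {x. P x}" "\<And>x y. P x \<Longrightarrow> P y \<Longrightarrow> P (x + y)" "\<And>a b. P (T a b)"
  shows "P x"
proof -
  have "P t" if "t \<in> span (range (case_prod T))" for t
    using that
  proof (induction rule: span_induct_alt)
    case base
    have "T (ofc 0 * 0) 0 = 0" unfolding tensor_ofc_left by simp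
    then show ?case using assms(3)[of "ofc 0 * 0" 0] by simp
  next
    case (step r t y)
    then obtain a b where "t = T a b" by auto
    then have "r *\<^sub>R t = T (r *\<^sub>R a) b" by (simp add: scaleR_ofc tensor_ofc_left)
    with step assms(2,3) show ?case by simp
  qed
  then have "closure (span (range (case_prod T))) \<subseteq> {x. P x}"
    using assms(1) by (intro closure_minimal) auto
  then show ?thesis using tensor_dense by auto
qed

lemma dense_eq:
  fixes F G :: "'c \<Rightarrow> 'd::real_normed_vector"
  assumes "bounded_linear F" "bounded_linear G" "\<And>a b. F (T a b) = G (T a b)"
  shows "F x = G x"
proof (induction x rule: dense_induct)
  case closed
  show ?case using assms by (intro closed_Collect_eq linear_continuous_on)
qed (use assms in \<open>simp_all add: linear_add bounded_linear.linear\<close>)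

lemma tensor_span_sum:
  assumes "t \<in> span (range (case_prod T))"
  shows "\<exists>(n::nat) a b. t = (\<Sum>i<n. T (a i) (b i))"
  using assms
proof (induction rule: span_induct_alt)
  case base
  show ?case by (rule exI[of _ 0]) simp
next
  case (step r t y)
  then obtain a0 b0 where t: "t = T a0 b0" by auto
  from step obtain n :: nat and a b where y: "y = (\<Sum>i<n. T (a i) (b i))" by blast
  have "r *\<^sub>R t + y = (\<Sum>i<Suc n. T ((a(n := r *\<^sub>R a0)) i) ((b(n := b0)) i))"
    by (simp add: t y scaleR_ofc tensor_ofc_left add.commute)
  then show ?case by blast
qed

lemma prodfun_tensor: "prodfun T f g h \<Longrightarrow> h (T a b) = f a * g b"
  by (simp add: prodfun_def)

lemma prodfun_unique: "prodfun T f g h \<Longrightarrow> prodfun T f g h' \<Longrightarrow> h x = h' x"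
  by (rule dense_eq) (auto simp: prodfun_def cfunctional_bounded_linear)

text \<open>Schur's product theorem for the Gram matrices \<open>f (a\<^sub>i\<^sup>* a\<^sub>j)\<close> and \<open>g (b\<^sub>i\<^sup>* b\<^sub>j)\<close>: one step of
  Gram--Schmidt on the \<open>b\<^sub>i\<close> splits off a positive summand.\<close>
lemma schur_product_positive:
  fixes f :: "'p::cstar \<Rightarrow> complex" and g :: "'q::cstar \<Rightarrow> complex"
  assumes f: "positive_functional f" and g: "positive_functional g" and "finite I"
  shows "cnonneg (\<Sum>i\<in>I. \<Sum>j\<in>I. f (adj (a i) * a j) * g (adj (b i) * b j))"
  using \<open>finite I\<close>
proof (induction I arbitrary: b)
  case empty
  show ?case by (simp add: cnonneg_def)
next
  case (insert k I)
  let ?J = "insert k I"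
  note fc = posf_c[OF f] and gc = posf_c[OF g]
  define p where "p = Re (g (adj (b k) * b k))"
  have p: "g (adj (b k) * b k) = of_real p" "0 \<le> p"
    using posf_nn[OF g, of "b k"] by (auto simp: p_def cnonneg_iff)
  \<comment> \<open>If \<open>c k\<close> is null for \<open>g\<close>, Cauchy--Schwarz kills the
    row and the column of index \<open>k\<close>.\<close>
  have drop: "(\<Sum>i\<in>?J. \<Sum>j\<in>?J. f (adj (a i) * a j) * g (adj (c i) * c j))
      = (\<Sum>i\<in>I. \<Sum>j\<in>I. f (adj (a i) * a j) * g (adj (c i) * c j))"
    if c: "g (adj (c k) * c k) = 0" for c
  proof -
    have "g (adj (c j) * c k) = 0" for j using posf_null[OF g c] .
    moreover from this have "g (adj (c k) * c j) = 0" for j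
      using posf_hermitian2[OF g, of "c k" "c j"] by simp
    ultimately show ?thesis using insert by simp
  qed
  show ?case
  proof (cases "p = 0")
    case True
    then show ?thesis using drop[of b] insert.IH[of b] p by simp
  next
    case False
    \<comment> \<open>\<open>l j * b k\<close> is the \<open>g\<close>-orthogonal projection of
      \<open>b j\<close> onto \<open>b k\<close>, and \<open>c j\<close> is the remainder; in
      particular \<open>c k = 0\<close>.\<close>
    define l where "l j = g (adj (b k) * b j) / of_real p" for j
    define c where "c j = b j + ofc (- l j) * b k" for j
    \<comment> \<open>The projections form a rank-one Gram matrix, whose share of the sum is
      \<open>p\<close> times \<open>f (adj z * z)\<close>.\<close>
    define z where "z = (\<Sum>j\<in>?J. ofc (l j) * a j)"
    have "ofc (- 1) = (-1 :: 'q)" by (simp add: ofc_minus)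
    moreover have lk: "l k = 1" using p False by (simp add: l_def)
    ultimately have ck: "c k = 0" by (simp add: c_def)
    have gl: "g (adj (b k) * b j) = l j * of_real p" for j
      using False by (simp add: l_def)
    then have gl': "g (adj (b j) * b k) = cnj (l j) * of_real p" for j
      using posf_hermitian2[OF g, of "b j" "b k"] by simp
    have gbc: "g (adj (b i) * b j) = g (adj (c i) * c j) + cnj (l i) * l j * of_real p" for i j
    proof -
      have "g (adj (c i) * c j) = g (adj (b i) * b j) + (- l j) * g (adj (b i) * b k)
         + cnj (- l i) * g (adj (b k) * b j) + cnj (- l i) * (- l j) * g (adj (b k) * b k)"
        unfolding c_def by (rule cfunctional_sesquilinear_shift[OF gc])
      then show ?thesis unfolding gl gl' by (simp add: lk algebra_simps)
    qed
    have fz: "f (adj z * z) = (\<Sum>i\<in>?J. \<Sum>j\<in>?J. cnj (l i) * l j * f (adj (a i) * a j))"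
      unfolding z_def linear_sum[OF bounded_linear.linear[OF bounded_linear_adj]] sum_product
        cfunctional_sum[OF fc] adj_ofc ofc_mult_ofc_mult cfunctional_ofc[OF fc] ..
    have "(\<Sum>i\<in>?J. \<Sum>j\<in>?J. f (adj (a i) * a j) * g (adj (b i) * b j)) =
       (\<Sum>i\<in>?J. \<Sum>j\<in>?J. f (adj (a i) * a j) * g (adj (c i) * c j)) + of_real p * f (adj z * z)"
      unfolding gbc fz by (simp only: distrib_left sum.distrib sum_distrib_left mult_ac)
    also have "\<dots> = (\<Sum>i\<in>I. \<Sum>j\<in>I. f (adj (a i) * a j) * g (adj (c i) * c j)) + of_real p * f (adj z * z)"
      by (subst drop) (simp_all add: ck cfunctional_0[OF gc])
    finally show ?thesis
      using insert.IH[of c] posf_nn[OF f, of z] p by (simp add: cnonneg_add cnonneg_scale)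
  qed
qed

text \<open>On finite sums of elementary tensors this is the Schur product theorem; density and
  continuity extend it.\<close>

lemma prodfun_positive:
  assumes f: "positive_functional f" and g: "positive_functional g" and h: "prodfun T f g h"
  shows "positive_functional h"
proof -
  have hc: "cfunctional h" using h by (simp add: prodfun_def)
  have "cnonneg (h (adj t * t))" if "t \<in> span (range (case_prod T))" for t
  proof -
    from tensor_span_sum[OF that] obtain n :: nat and a b where t: "t = (\<Sum>i<n. T (a i) (b i))" by blast
    have "h (adj t * t) = (\<Sum>i<n. \<Sum>j<n. f (adj (a i) * a j) * g (adj (b i) * b j))"
      unfolding t linear_sum[OF bounded_linear.linear[OF bounded_linear_adj]] sum_product
        cfunctional_sum[OF hc] tensor_adj tensor_mult[symmetric] prodfun_tensor[OF h] ..
    then show ?thesis using schur_product_positive[OF f g, of "{..<n}" a b] by simp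
  qed
  moreover have "closed {t. cnonneg (h (adj t * t))}"
  proof -
    have "continuous_on UNIV (\<lambda>t. h (adj t * t))"
      by (intro continuous_on_compose2[OF cfunctional_continuous[OF hc, of UNIV]] continuous_intros
          linear_continuous_on bounded_linear_adj) auto
    from closed_vimage[OF closed_cnonneg this] show ?thesis by (simp add: vimage_def)
  qed
  ultimately have "closure (span (range (case_prod T))) \<subseteq> {t. cnonneg (h (adj t * t))}"
    by (intro closure_minimal) auto
  then show ?thesis using hc tensor_dense by (auto simp: positive_functional_def)
qed

end

subsection \<open>Hahn--Banach and uniform boundedness\<close>

text \<open>Homogeneity is stated as an inequality, which infima inherit directly; scaling back by
  \<open>1 / r\<close> recovers equality.\<close>

definition sublinear :: "('a::real_vector \<Rightarrow> real) \<Rightarrow> bool" where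
  "sublinear q \<longleftrightarrow> (\<forall>x y. q (x + y) \<le> q x + q y) \<and> (\<forall>r>0. \<forall>x. q (r *\<^sub>R x) \<le> r * q x)"

lemma sublinearI:
  assumes "\<And>x y. q (x + y) \<le> q x + q y" "\<And>r x. 0 < r \<Longrightarrow> q (r *\<^sub>R x) \<le> r * q x"
  shows "sublinear q"
  using assms by (auto simp: sublinear_def)

context
  fixes q :: "'a::real_vector \<Rightarrow> real"
  assumes sl: "sublinear q"
begin

lemma sublinear_add: "q (x + y) \<le> q x + q y"
  using sl by (simp add: sublinear_def)

lemma sublinear_scale: "0 < r \<Longrightarrow> q (r *\<^sub>R x) = r * q x"
proof (rule antisym)
  assume r: "0 < r"
  show "q (r *\<^sub>R x) \<le> r * q x" using sl r by (simp add: sublinear_def)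
  have "q (inverse r *\<^sub>R (r *\<^sub>R x)) \<le> inverse r * q (r *\<^sub>R x)"
    using sl r by (metis sublinear_def positive_imp_inverse_positive)
  then show "r * q x \<le> q (r *\<^sub>R x)" using r by (simp add: field_simps)
qed

lemma sublinear_0: "q 0 = 0"
  using sublinear_scale[of 2 0] by simp

lemma sublinear_scale_nonneg: "0 \<le> r \<Longrightarrow> q (r *\<^sub>R x) = r * q x"
  by (cases "r = 0") (auto simp: sublinear_0 sublinear_scale)

lemma sublinear_minus: "- q (- x) \<le> q x"
  using sublinear_add[of x "- x"] by (simp add: sublinear_0)

text \<open>Take the infimum over \<open>t \<ge> 0\<close> of \<open>q (x + t x0) - t q x0\<close>;
  the values \<open>t = 0\<close> and \<open>t = 1\<close> give the two bounds. If \<open>q\<close>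
  is minimal, then \<open>q' = q\<close> and the second bound is superadditivity.\<close>

lemma sublinear_shift:
  shows "\<exists>q'. sublinear q' \<and> (\<forall>x. q' x \<le> q x) \<and> (\<forall>x. q' x \<le> q (x + x0) - q x0)"
proof -
  define F where "F x t = q (x + t *\<^sub>R x0) - t * q x0" for x t
  define q' where "q' x = (INF t\<in>{0..}. F x t)" for x
  have bdd: "bdd_below (F x ` {0..})" for x
  proof (rule bdd_belowI2)
    fix t :: real assume "t \<in> {0..}"
    then have "t * q x0 \<le> q (x + t *\<^sub>R x0) + q (- x)"
      using sublinear_add[of "x + t *\<^sub>R x0" "- x"] by (simp add: sublinear_scale_nonneg)
    then show "- q (- x) \<le> F x t" by (simp add: F_def)
  qed
  have le: "q' x \<le> F x t" if "0 \<le> t" for x t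
    unfolding q'_def using that by (intro cINF_lower bdd) auto
  have ge: "c \<le> q' x" if "\<And>t. 0 \<le> t \<Longrightarrow> c \<le> F x t" for c x
    unfolding q'_def using that by (intro cINF_greatest) auto
  have "sublinear q'"
  proof (rule sublinearI)
    fix x y
    have "q' (x + y) - F y s \<le> F x t" if "0 \<le> s" "0 \<le> t" for s t
    proof -
      have "q' (x + y) \<le> F (x + y) (t + s)" using that by (intro le) simp
      also have "\<dots> \<le> F x t + F y s"
        using sublinear_add[of "x + t *\<^sub>R x0" "y + s *\<^sub>R x0"] by (simp add: F_def algebra_simps)
      finally show ?thesis by simp
    qed
    then have "q' (x + y) - q' x \<le> F y s" if "0 \<le> s" for s
      using ge[of "q' (x + y) - F y s" x] that by simp
    then show "q' (x + y) \<le> q' x + q' y" using ge[of "q' (x + y) - q' x" y] by simp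
  next
    fix r :: real and x assume r: "0 < r"
    have "q' (r *\<^sub>R x) / r \<le> F x t" if "0 \<le> t" for t
    proof -
      have "q' (r *\<^sub>R x) \<le> F (r *\<^sub>R x) (r * t)" using that r by (intro le) simp
      also have "\<dots> = r * F x t"
        using sublinear_scale[OF r, of "x + t *\<^sub>R x0"] by (simp add: F_def algebra_simps)
      finally show ?thesis using r by (simp add: field_simps)
    qed
    then show "q' (r *\<^sub>R x) \<le> r * q' x"
      using ge[of "q' (r *\<^sub>R x) / r" x] r by (simp add: field_simps)
  qed
  then show ?thesis using le[of 0] le[of 1] by (auto simp: F_def)
qed

end

text \<open>A minimal sublinear functional below a given one is linear.\<close>
theorem hahn_banach_sublinear:
  fixes p :: "'a::real_vector \<Rightarrow> real"
  assumes p: "sublinear p"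
  shows "\<exists>f. linear f \<and> (\<forall>x. f x \<le> p x) \<and> f x0 = p x0"
proof -
  \<comment> \<open>Starting from the shifted functional forces the value at \<open>x0\<close>:
    \<open>p' (- x0) \<le> - p x0\<close>.\<close>
  obtain p' where p': "sublinear p'" "\<And>x. p' x \<le> p x" "\<And>x. p' x \<le> p (x + x0) - p x0"
    using sublinear_shift[OF p] by blast
  define A where "A = {q. sublinear q \<and> q \<le> p'}"
  \<comment> \<open>Zorn's lemma for the reversed order; a nonempty chain is bounded by its
    pointwise infimum.\<close>
  have "\<exists>m\<in>A. \<forall>a\<in>A. a \<le> m \<longrightarrow> a = m"
  proof (rule predicate_Zorn)
    show "partial_order_on A (relation_of (\<lambda>x y. y \<le> x) A)"
      by (rule partial_order_on_relation_ofI) auto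
    fix C assume C: "C \<in> Chains (relation_of (\<lambda>x y. y \<le> x) A)"
    then have CA: "C \<subseteq> A" and chain: "\<And>a b. a \<in> C \<Longrightarrow> b \<in> C \<Longrightarrow> a \<le> b \<or> b \<le> a"
      unfolding Chains_def relation_of_def by auto
    show "\<exists>u\<in>A. \<forall>a\<in>C. u \<le> a"
    proof (cases "C = {}")
      case True
      then show ?thesis using p'(1) by (auto simp: A_def)
    next
      case False
      define u where "u x = (INF q\<in>C. q x)" for x
      have bdd: "bdd_below ((\<lambda>q. q x) ` C)" for x
      proof (rule bdd_belowI2)
        fix q assume "q \<in> C"
        with CA have "sublinear q" "q (- x) \<le> p' (- x)" by (auto simp: A_def le_fun_def)
        then show "- p' (- x) \<le> q x" using sublinear_minus[of q x] by simp
      qed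
      have le: "u x \<le> q x" if "q \<in> C" for x q
        unfolding u_def using that by (intro cINF_lower bdd)
      have ge: "c \<le> u x" if "\<And>q. q \<in> C \<Longrightarrow> c \<le> q x" for c x
        unfolding u_def using that False by (intro cINF_greatest)
      have "sublinear u"
      proof (rule sublinearI)
        fix x y
        have "u (x + y) - b y \<le> a x" if ab: "a \<in> C" "b \<in> C" for a b
        proof -
          \<comment> \<open>The chain condition supplies one member below both \<open>a\<close> and
            \<open>b\<close>, whose subadditivity is then used.\<close>
          obtain c where c: "c \<in> C" "c \<le> a" "c \<le> b" using chain[OF ab] ab by blast
          then have "u (x + y) \<le> c x + c y"
            using le[OF c(1), of "x + y"] sublinear_add[of c x y] CA by (force simp: A_def)
          then show ?thesis using c(2,3) by (smt (verit) le_funD)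
        qed
        then have "u (x + y) - u x \<le> b y" if "b \<in> C" for b
          using ge[of "u (x + y) - b y" x] that by simp
        then show "u (x + y) \<le> u x + u y" using ge[of "u (x + y) - u x" y] by simp
      next
        fix r :: real and x assume r: "0 < r"
        have "u (r *\<^sub>R x) / r \<le> q x" if "q \<in> C" for q
          using le[OF that, of "r *\<^sub>R x"] sublinear_scale[of q r x] CA that r
          by (auto simp: A_def field_simps)
        then show "u (r *\<^sub>R x) \<le> r * u x"
          using ge[of "u (r *\<^sub>R x) / r" x] r by (simp add: field_simps)
      qed
      moreover obtain q where "q \<in> C" using False by blast
      moreover from this have "u \<le> q" "q \<le> p'" using le CA by (auto simp: A_def le_fun_def)
      ultimately show ?thesis
        using le by (intro bexI[of _ u]) (auto simp: A_def le_fun_def intro: order_trans)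
    qed
  qed
  then obtain m where m: "sublinear m" "m \<le> p'" and min: "\<And>a. sublinear a \<Longrightarrow> a \<le> m \<Longrightarrow> a = m"
    unfolding A_def by (smt (verit) mem_Collect_eq order_trans)
  have add: "m (x + y) = m x + m y" for x y
  proof (rule antisym)
    obtain m' where "sublinear m'" "\<And>x. m' x \<le> m x" and s: "\<And>x. m' x \<le> m (x + y) - m y"
      using sublinear_shift[OF m(1)] by blast
    then have "m' = m" by (intro min) (auto simp: le_fun_def)
    then show "m x + m y \<le> m (x + y)" using s[of x] by simp
  qed (rule sublinear_add[OF m(1)])
  have neg: "m (- x) = - m x" for x using add[of x "- x"] sublinear_0[OF m(1)] by simp
  have "linear m"
  proof (rule linearI)
    fix r :: real and x
    show "m (r *\<^sub>R x) = r *\<^sub>R m x"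
    proof (cases "0 \<le> r")
      case False
      then have "m (- r *\<^sub>R x) = - r * m x" by (intro sublinear_scale_nonneg[OF m(1)]) simp
      then show ?thesis using neg[of "r *\<^sub>R x"] by simp
    qed (simp add: sublinear_scale_nonneg[OF m(1)])
  qed (rule add)
  moreover have le: "m x \<le> p' x" for x using m(2) by (simp add: le_fun_def)
  moreover have "p x0 \<le> m x0"
    using le[of "- x0"] p'(3)[of "- x0"] neg[of x0] sublinear_0[OF p] by simp
  ultimately show ?thesis using p'(2) by (meson order_trans antisym)
qed

text \<open>Apply Hahn--Banach to the norm; its bound at \<open>- x\<close> makes the estimate
  two-sided.\<close>

corollary norming_functional:
  fixes x0 :: "'a::real_normed_vector"
  obtains g :: "'a \<Rightarrow>\<^sub>L real" where "norm g \<le> 1" "blinfun_apply g x0 = norm x0"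
proof -
  have "sublinear (norm :: 'a \<Rightarrow> real)" by (rule sublinearI) (auto simp: norm_triangle_ineq)
  from hahn_banach_sublinear[OF this, of x0]
  obtain f :: "'a \<Rightarrow> real" where f: "linear f" "\<And>x. f x \<le> norm x" "f x0 = norm x0" by blast
  have le: "\<bar>f x\<bar> \<le> norm x" for x
    using f(2)[of x] f(2)[of "- x"] linear_neg[OF f(1), of x] by simp
  then have bl: "bounded_linear f"
    using f(1) by (intro bounded_linear_intro[where K = 1]) (auto simp: linear_add linear_scale)
  show thesis
  proof (rule that[of "Blinfun f"])
    show "norm (Blinfun f) \<le> 1"
      using le by (intro norm_blinfun_bound) (auto simp: bounded_linear_Blinfun_apply[OF bl])
    show "blinfun_apply (Blinfun f) x0 = norm x0"
      by (simp add: bounded_linear_Blinfun_apply[OF bl] f(3))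
  qed
qed

text \<open>Sokal's gliding hump in the dual space.\<close>
theorem weakly_bounded_imp_bounded:
  fixes S :: "'a::real_normed_vector set"
  assumes weak: "\<And>g :: 'a \<Rightarrow>\<^sub>L real. \<exists>K. \<forall>s\<in>S. \<bar>blinfun_apply g s\<bar> \<le> K"
  shows "\<exists>C. \<forall>s\<in>S. norm s \<le> C"
proof (rule ccontr)
  assume unb: "\<not> ?thesis"
  have "\<exists>s. \<forall>n. s n \<in> S \<and> 4 ^ n < norm (s n)"
    by (rule choice) (use unb not_le in blast)
  then obtain s where s: "\<And>n. s n \<in> S" "\<And>n::nat. 4 ^ n < norm (s n)" by blast
  have step: "\<exists>g. norm (g - f) \<le> (1/3) ^ n \<and> (1/3) ^ n * norm (s n) \<le> \<bar>blinfun_apply g (s n)\<bar>"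
    for f :: "'a \<Rightarrow>\<^sub>L real" and n :: nat
  proof -
    obtain g :: "'a \<Rightarrow>\<^sub>L real" where g: "norm g \<le> 1" "blinfun_apply g (s n) = norm (s n)"
      by (rule norming_functional)
    define r where "r = (1/3 :: real) ^ n"
    have r: "norm (r *\<^sub>R g) \<le> r" "0 < r" using g(1) by (simp_all add: r_def)
    \<comment> \<open>The two values differ by \<open>2 * r * norm (s n)\<close>, so one of them is
      large.\<close>
    have "r * norm (s n) \<le> \<bar>blinfun_apply (f + r *\<^sub>R g) (s n)\<bar>
        \<or> r * norm (s n) \<le> \<bar>blinfun_apply (f - r *\<^sub>R g) (s n)\<bar>"
      by (simp add: blinfun.bilinear_simps g(2)) linarith
    then show ?thesis
      unfolding r_def[symmetric] using r
      by (elim disjE; intro exI[of _ "f + r *\<^sub>R g"] exI[of _ "f - r *\<^sub>R g"]) auto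
  qed
  obtain F where F: "\<And>n. norm (F (Suc n) - F n) \<le> (1/3) ^ n"
    "\<And>n. (1/3) ^ n * norm (s n) \<le> \<bar>blinfun_apply (F (Suc n)) (s n)\<bar>"
    using dependent_nat_choice[of "\<lambda>_ _. True"
        "\<lambda>n f g. norm (g - f) \<le> (1/3) ^ n \<and> (1/3) ^ n * norm (s n) \<le> \<bar>blinfun_apply g (s n)\<bar>"]
      step by auto
  have tail: "norm (F (m + k) - F m) \<le> 3/2 * (1/3) ^ m - 3/2 * (1/3) ^ (m + k)" for m k
  proof (induction k)
    case (Suc k)
    have "norm (F (m + Suc k) - F m) \<le> norm (F (Suc (m + k)) - F (m + k)) + norm (F (m + k) - F m)"
      using norm_triangle_ineq[of "F (Suc (m + k)) - F (m + k)" "F (m + k) - F m"] by simp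
    moreover have "(1/3 :: real) ^ (m + Suc k) = 1/3 * (1/3) ^ (m + k)" by simp
    ultimately show ?case using Suc F(1)[of "m + k"] by linarith
  qed simp
  have tail': "norm (F n - F m) \<le> 3/2 * (1/3) ^ m" if "m \<le> n" for m n
  proof -
    have "(0::real) \<le> (1/3) ^ (m + (n - m))" by simp
    then have "norm (F (m + (n - m)) - F m) \<le> 3/2 * (1/3) ^ m" using tail[of m "n - m"] by linarith
    then show ?thesis using that by simp
  qed
  have "Cauchy F"
  proof (rule metric_CauchyI)
    fix e :: real assume "0 < e"
    then obtain M where M: "(1/3 :: real) ^ M < e / 3"
      using real_arch_pow_inv[of "e / 3" "1/3"] by auto
    have "dist (F m) (F n) < e" if "M \<le> m" "M \<le> n" for m n
      using tail'[OF that(1)] tail'[OF that(2)] M dist_triangle2[of "F m" "F n" "F M"]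
      by (simp add: dist_norm)
    then show "\<exists>M. \<forall>m\<ge>M. \<forall>n\<ge>M. dist (F m) (F n) < e" by blast
  qed
  then obtain g where g: "F \<longlonglongrightarrow> g" unfolding Cauchy_convergent_iff convergent_def by blast
  have close: "norm (g - F m) \<le> 3/2 * (1/3) ^ m" for m
  proof (rule tendsto_upperbound)
    show "(\<lambda>n. norm (F n - F m)) \<longlonglongrightarrow> norm (g - F m)" by (intro tendsto_intros g)
    show "\<forall>\<^sub>F n in sequentially. norm (F n - F m) \<le> 3/2 * (1/3) ^ m"
      using tail' eventually_ge_at_top[of m] by (rule eventually_mono[rotated])
  qed simp
  \<comment> \<open>All corrections after stage \<open>n\<close> together remove at most half of the
    value secured there, and \<open>4 ^ n\<close> outgrows \<open>3 ^ n\<close>.\<close>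
  have big: "(1/2) * (4/3) ^ n \<le> \<bar>blinfun_apply g (s n)\<bar>" for n :: nat
  proof -
    have "\<bar>blinfun_apply (g - F (Suc n)) (s n)\<bar> \<le> norm (g - F (Suc n)) * norm (s n)"
      using norm_blinfun[of "g - F (Suc n)" "s n"] by simp
    also have "\<dots> \<le> 1/2 * (1/3) ^ n * norm (s n)"
      using close[of "Suc n"] by (intro mult_right_mono) auto
    finally have "1/2 * (1/3) ^ n * norm (s n) \<le> \<bar>blinfun_apply g (s n)\<bar>"
      using F(2)[of n] unfolding blinfun.diff_left by linarith
    moreover have "(1/2) * (4/3) ^ n \<le> 1/2 * (1/3) ^ n * norm (s n)"
      using s(2)[of n] by (simp add: power_divide field_simps)
    ultimately show ?thesis by linarith
  qed
  obtain K where "\<And>t. t \<in> S \<Longrightarrow> \<bar>blinfun_apply g t\<bar> \<le> K" using weak[of g] by blast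
  then have K: "(1/2) * (4/3) ^ n \<le> K" for n :: nat using big s(1) order_trans by blast
  obtain n where "2 * K < (4/3) ^ n" using real_arch_pow[of "4/3" "2 * K"] by auto
  with K[of n] show False by linarith
qed

text \<open>The usual complexification \<open>g a - i g (i a)\<close> carries the real duality
  theorems over to \<open>cfunctional\<close>.\<close>

lemma cfunctional_of_real_functional:
  fixes g :: "'a::cstar \<Rightarrow>\<^sub>L real"
  shows "\<exists>f. cfunctional f \<and> (\<forall>a. Re (f a) = blinfun_apply g a)"
proof -
  define f where "f a = Complex (blinfun_apply g a) (- blinfun_apply g (ofc \<i> * a))" for a
  have "cfunctional f"
  proof (rule cfunctional_intro)
    show "f (a + b) = f a + f b" for a b
      by (simp add: f_def blinfun.bilinear_simps distrib_left complex_eq_iff)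
    show "f (ofc c * a) = c * f a" for c a
    proof -
      have "ofc c = Re c *\<^sub>R 1 + Im c *\<^sub>R (ofc \<i> :: 'a)"
      proof -
        have "c = of_real (Re c) + of_real (Im c) * \<i>" by (simp add: complex_eq_iff)
        then have "ofc c = ofc (of_real (Re c)) + ofc (of_real (Im c)) * (ofc \<i> :: 'a)"
          by (metis ofc_add ofc_mult)
        then show ?thesis by (simp only: ofc_of_real mult_scaleR_left mult_1)
      qed
      moreover have "ofc \<i> * (ofc \<i> * a) = - a"
        by (simp add: mult.assoc[symmetric] ofc_mult[symmetric] ofc_minus)
      ultimately show ?thesis
        by (simp add: f_def complex_eq_iff blinfun.bilinear_simps distrib_left distrib_right)
    qed
    show "cmod (f a) \<le> (norm g + norm g) * norm a" for a
    proof -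
      have "cmod (f a) \<le> \<bar>Re (f a)\<bar> + \<bar>Im (f a)\<bar>" by (rule cmod_le)
      also have "\<dots> \<le> norm g * norm a + norm g * norm (ofc \<i> * a)"
        using norm_blinfun[of g] by (intro add_mono) (simp_all add: f_def del: norm_ofc)
      finally show ?thesis by (simp add: norm_ofc algebra_simps)
    qed
  qed
  then show ?thesis by (intro exI[of _ f]) (simp add: f_def)
qed

lemma cfunctional_separate:
  fixes a b :: "'a::cstar"
  assumes "\<And>f. cfunctional f \<Longrightarrow> f a = f b"
  shows "a = b"
proof -
  obtain g :: "'a \<Rightarrow>\<^sub>L real" where g: "blinfun_apply g (a - b) = norm (a - b)"
    by (rule norming_functional)
  obtain f where f: "cfunctional f" "Re (f (a - b)) = norm (a - b)"
    using cfunctional_of_real_functional[of g] g by auto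
  then have "norm (a - b) = 0" using assms[OF f(1)] by (simp add: cfunctional_diff)
  then show ?thesis by simp
qed

lemma cfunctional_weakly_bounded:
  fixes S :: "'a::cstar set"
  assumes "\<And>f. cfunctional f \<Longrightarrow> \<exists>K. \<forall>s\<in>S. cmod (f s) \<le> K"
  shows "\<exists>C. \<forall>s\<in>S. norm s \<le> C"
proof (rule weakly_bounded_imp_bounded)
  fix g :: "'a \<Rightarrow>\<^sub>L real"
  obtain f where f: "cfunctional f" "\<And>a. Re (f a) = blinfun_apply g a"
    using cfunctional_of_real_functional[of g] by blast
  obtain K where "\<forall>s\<in>S. cmod (f s) \<le> K" using assms[OF f(1)] by blast
  then show "\<exists>K. \<forall>s\<in>S. \<bar>blinfun_apply g s\<bar> \<le> K"
    using abs_Re_le_cmod f(2) by (metis order_trans)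
qed

section \<open>Star homomorphisms and their automatic continuity\<close>

lemma
  fixes D :: "'a::cstar \<Rightarrow> 'b::cstar"
  assumes "star_hom D"
  shows star_hom_add: "D (a + b) = D a + D b"
    and star_hom_ofc: "D (ofc c * a) = ofc c * D a"
    and star_hom_mult: "D (a * b) = D a * D b"
    and star_hom_adj: "D (adj a) = adj (D a)"
    and star_hom_1: "D 1 = 1"
    and star_hom_scaleR: "D (r *\<^sub>R a) = r *\<^sub>R D a"
    and star_hom_linear: "linear D"
proof -
  show add: "D (a + b) = D a + D b" and "D (ofc c * a) = ofc c * D a" and "D (a * b) = D a * D b"
    and "D (adj a) = adj (D a)" and "D 1 = 1" for a b c
    using assms unfolding star_hom_def by blast+
  show sc: "D (r *\<^sub>R a) = r *\<^sub>R D a" for r a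
    using assms unfolding star_hom_def scaleR_ofc by blast
  show "linear D" by (rule linearI) (simp_all add: add sc)
qed

text \<open>The square root of \<open>1 - b\<close> is \<open>1 - z\<close>, where \<open>z\<close> is the fixed point of \<open>z \<mapsto> (b + z\<^sup>2) / 2\<close>.\<close>
lemma one_minus_selfadjoint_square:
  fixes b :: "'a::cstar"
  assumes "adj b = b" "norm b \<le> 3/4"
  shows "\<exists>c. 1 - b = adj c * c"
proof -
  \<comment> \<open>On this ball \<open>F\<close> contracts by 1/2, and it preserves the ball
    because 3/4 + 1/4 = 1.\<close>
  define X where "X = {z :: 'a. adj z = z \<and> norm z \<le> 1/2}"
  define F where "F z = (1/2) *\<^sub>R (b + z * z)" for z
  have "closed X"
    unfolding X_def
    by (intro closed_Collect_conj closed_Collect_eq closed_Collect_le continuous_intros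
        linear_continuous_on bounded_linear_adj)
  then have "complete X" by (simp add: complete_eq_closed)
  moreover have "0 \<in> X" by (simp add: X_def)
  then have "X \<noteq> {}" by blast
  moreover have "F ` X \<subseteq> X"
  proof safe
    fix z assume z: "z \<in> X"
    then have "norm (z * z) \<le> 1/2 * (1/2)"
      by (intro order_trans[OF norm_mult_ineq] mult_mono) (auto simp: X_def)
    then have "norm (b + z * z) \<le> 1" using assms(2) norm_triangle_ineq[of b "z * z"] by simp
    then show "F z \<in> X" using z assms(1) by (simp add: X_def F_def adj_scaleR adj_add adj_mult)
  qed
  moreover have "dist (F x) (F y) \<le> 1/2 * dist x y" if "x \<in> X" "y \<in> X" for x y
  proof -
    have "F x - F y = (1/2) *\<^sub>R (x * (x - y) + (x - y) * y)"
      by (simp add: F_def algebra_simps flip: scaleR_diff_right)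
    moreover have "norm (x * (x - y) + (x - y) * y) \<le> 1/2 * norm (x - y) + norm (x - y) * (1/2)"
      using that
      by (intro order_trans[OF norm_triangle_ineq] add_mono order_trans[OF norm_mult_ineq] mult_mono)
        (auto simp: X_def)
    ultimately show ?thesis by (simp add: dist_norm)
  qed
  ultimately have "\<exists>!z. z \<in> X \<and> F z = z" by (intro Banach_fix[where c = "1/2"]) auto
  then obtain z where z: "z \<in> X" "F z = z" by blast
  have "b + z * z = 2 *\<^sub>R F z" by (simp add: F_def)
  also have "\<dots> = z + z" by (simp add: z(2) scaleR_2)
  finally have "1 - b = (1 - z) * (1 - z)" by (simp add: algebra_simps)
  then show ?thesis using z(1) by (intro exI[of _ "1 - z"]) (simp add: adj_diff X_def)
qed

context
  fixes T :: "'a::cstar \<Rightarrow> 'b::cstar \<Rightarrow> 'c::cstar" and f0 :: "'a \<Rightarrow> complex" and g0 :: "'b \<Rightarrow> complex"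
  assumes mt: "min_tensor T" and f0: "state f0" and g0: "state g0"
begin

text \<open>The functionals in the supremum defining the norm are compressions of product states,
  hence states. The product of \<open>f0\<close> and \<open>g0\<close> shows that the supremum is
  over a nonempty set.\<close>

lemma norm_le_by_states:
  assumes "\<And>H. state H \<Longrightarrow> Re (H (adj x * x)) \<le> M"
  shows "(norm (x::'c))\<^sup>2 \<le> M"
proof -
  have "Sup {Re (h (adj y * adj x * x * y)) | f g h y.
            state f \<and> state g \<and> prodfun T f g h \<and> h (adj y * y) = 1} \<le> M"
  proof (rule cSup_least)
    obtain h where h: "prodfun T f0 g0 h"
      using tensor_prodfun_ex[OF mt] f0 g0 unfolding state_def by blast
    then have "h (adj 1 * 1) = 1"
      using prodfun_tensor[OF mt h, of 1 1] f0 g0 by (simp add: tensor_1_1[OF mt] state_def)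
    with h f0 g0 show "{Re (h (adj y * adj x * x * y)) | f g h y.
            state f \<and> state g \<and> prodfun T f g h \<and> h (adj y * y) = 1} \<noteq> {}" by blast
  next
    fix r assume "r \<in> {Re (h (adj y * adj x * x * y)) | f g h y.
            state f \<and> state g \<and> prodfun T f g h \<and> h (adj y * y) = 1}"
    then obtain f g h y where r: "r = Re (h (adj y * (adj x * x) * y))"
      and fgh: "state f" "state g" "prodfun T f g h" and y: "h (adj y * y) = 1"
      by (auto simp: mult.assoc)
    have "positive_functional h"
      using fgh by (intro prodfun_positive[OF mt]) (auto simp: state_iff)
    then have "positive_functional (\<lambda>a. h (adj y * a * y))" by (rule posf_compress)
    then have "state (\<lambda>a. h (adj y * a * y))" using y by (simp add: state_iff)
    from assms[OF this] show "r \<le> M" by (simp add: r)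
  qed
  then show ?thesis by (simp only: tensor_norm[OF mt, of x])
qed

text \<open>For \<open>norm a \<le> 1/2\<close> the element \<open>1 - adj a * a\<close> is a square
  \<open>adj c * c\<close>. Applying \<open>D\<close> and any state \<open>H\<close> gives
  \<open>H (adj (D a) * D a) \<le> 1\<close>, and states control the norm of the tensor
  product.\<close>

lemma star_hom_bounded_linear:
  fixes D :: "'d::cstar \<Rightarrow> 'c"
  assumes D: "star_hom D"
  shows "bounded_linear D"
proof -
  have small: "norm (D a) \<le> 1" if a: "norm a \<le> 1/2" for a
  proof -
    let ?b = "adj a * a"
    have "norm ?b \<le> (1/2)\<^sup>2" unfolding cstar_identity by (intro power_mono a) simp
    then obtain c where c: "1 - ?b = adj c * c"
      using one_minus_selfadjoint_square[of ?b] by (auto simp: adj_mult adj_adj power2_eq_square)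
    have "(norm (D a))\<^sup>2 \<le> 1"
    proof (rule norm_le_by_states)
      fix H :: "'c \<Rightarrow> complex" assume H: "state H"
      then have pH: "positive_functional H" and "H 1 = 1" by (auto simp: state_iff)
      have "adj (D c) * D c = 1 - adj (D a) * D a"
        using arg_cong[OF c, of D] linear_diff[OF star_hom_linear[OF D], of 1 ?b]
        by (simp add: star_hom_mult[OF D] star_hom_adj[OF D] star_hom_1[OF D])
      then show "Re (H (adj (D a) * D a)) \<le> 1"
        using posf_nn[OF pH, of "D c"] cfunctional_diff[OF posf_c[OF pH]] \<open>H 1 = 1\<close>
        by (simp add: cnonneg_def)
    qed
    then show ?thesis by (simp add: power_le_one_iff abs_square_le_1)
  qed
  have "norm (D a) \<le> norm a * 2" for a
  proof (cases "a = 0")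
    case False
    then have "norm (D ((1 / (2 * norm a)) *\<^sub>R a)) \<le> 1" by (intro small) simp
    then show ?thesis using False by (simp add: star_hom_scaleR[OF D] field_simps)
  qed (simp add: linear_0[OF star_hom_linear[OF D]])
  then show ?thesis
    by (intro bounded_linear_intro[where K = 2]) (simp_all add: star_hom_add[OF D] star_hom_scaleR[OF D])
qed

lemma star_hom_tensor_unit: "star_hom (\<lambda>a. T a 1)"
  unfolding star_hom_def
  using tensor_add_left[OF mt] tensor_ofc_left[OF mt] tensor_left_mult[OF mt] tensor_adj[OF mt, of _ 1]
    tensor_1_1[OF mt] by auto

end

lemma state_star_hom:
  assumes "state H" "star_hom D" "bounded_linear D"
  shows "state (\<lambda>a. H (D a))"
  unfolding state_iff positive_functional_def
proof (intro conjI allI)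
  note H = assms(1)[unfolded state_iff positive_functional_def]
  show "cfunctional (\<lambda>a. H (D a))"
    by (rule cfunctional_comp_bounded_linear[OF _ assms(3)]) (use H star_hom_ofc[OF assms(2)] in auto)
  show "cnonneg (H (D (adj x * x)))" for x
    using H by (simp add: star_hom_mult[OF assms(2)] star_hom_adj[OF assms(2)])
  show "H (D 1) = 1" using H by (simp add: star_hom_1[OF assms(2)])
qed

subsection \<open>Slice maps\<close>

context
  fixes T :: "'a::cstar \<Rightarrow> 'b::cstar \<Rightarrow> 'c::cstar" and g :: "'b \<Rightarrow> complex"
  assumes mt: "min_tensor T" and g: "cfunctional g"
begin

text \<open>A weak form of the slice map, kept as a relation until existence and uniqueness of the
  value are known.\<close>

definition slice_rel :: "'c \<Rightarrow> 'a \<Rightarrow> bool" where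
  "slice_rel t s \<longleftrightarrow> (\<forall>f h. cfunctional f \<longrightarrow> prodfun T f g h \<longrightarrow> h t = f s)"

lemma slice_rel_add: "slice_rel t s \<Longrightarrow> slice_rel t' s' \<Longrightarrow> slice_rel (t + t') (s + s')"
  unfolding slice_rel_def by (metis cfunctional_add prodfun_def)

lemma slice_rel_scaleR: "slice_rel t s \<Longrightarrow> slice_rel (r *\<^sub>R t) (r *\<^sub>R s)"
  unfolding slice_rel_def by (metis cfunctional_scaleR prodfun_def)

lemma slice_rel_diff: "slice_rel t s \<Longrightarrow> slice_rel t' s' \<Longrightarrow> slice_rel (t - t') (s - s')"
  unfolding slice_rel_def by (metis cfunctional_diff prodfun_def)

lemma slice_rel_tensor: "slice_rel (T a b) (ofc (g b) * a)"
  unfolding slice_rel_def by (metis cfunctional_ofc prodfun_tensor[OF mt] mult.commute)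

lemma slice_rel_unique:
  assumes "slice_rel t s" "slice_rel t s'"
  shows "s = s'"
proof (rule cfunctional_separate)
  fix f :: "'a \<Rightarrow> complex" assume f: "cfunctional f"
  then obtain h where "prodfun T f g h" using tensor_prodfun_ex[OF mt f g] by blast
  with f assms show "f s = f s'" unfolding slice_rel_def by metis
qed

text \<open>The slices of the unit ball are weakly bounded because each product functional is bounded.\<close>
lemma slice_rel_bound: "\<exists>C. 0 \<le> C \<and> (\<forall>t s. slice_rel t s \<longrightarrow> norm s \<le> C * norm t)"
proof -
  have "\<exists>C. \<forall>s\<in>{s. \<exists>t. norm t \<le> 1 \<and> slice_rel t s}. norm s \<le> C"
  proof (rule cfunctional_weakly_bounded)
    fix f :: "'a \<Rightarrow> complex" assume f: "cfunctional f"
    then obtain h where h: "prodfun T f g h" using tensor_prodfun_ex[OF mt f g] by blast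
    then have "bounded_linear h" by (intro cfunctional_bounded_linear) (simp add: prodfun_def)
    then obtain K where K: "0 \<le> K" "\<And>t. cmod (h t) \<le> norm t * K"
      using bounded_linear.nonneg_bounded by blast
    have "cmod (f s) \<le> K" if "norm t \<le> 1" "slice_rel t s" for s t
    proof -
      have "h t = f s" using that(2) f h unfolding slice_rel_def by blast
      then have "cmod (f s) = cmod (h t)" by simp
      also have "\<dots> \<le> 1 * K" using K that by (meson mult_right_mono order_trans)
      finally show ?thesis by simp
    qed
    then show "\<exists>K. \<forall>s\<in>{s. \<exists>t. norm t \<le> 1 \<and> slice_rel t s}. cmod (f s) \<le> K" by blast
  qed
  then obtain C where C: "\<And>s t. norm t \<le> 1 \<Longrightarrow> slice_rel t s \<Longrightarrow> norm s \<le> C" by blast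
  have "norm s \<le> \<bar>C\<bar> * norm t" if st: "slice_rel t s" for s t
  proof (cases "t = 0")
    case True
    have "slice_rel 0 0" using slice_rel_diff[OF st st] by simp
    with st True have "s = 0" by (auto intro: slice_rel_unique)
    then show ?thesis by simp
  next
    case False
    then have "norm ((1 / norm t) *\<^sub>R s) \<le> C" by (intro C[OF _ slice_rel_scaleR[OF st]]) simp
    then have "norm s \<le> C * norm t" using False by (simp add: field_simps)
    then show ?thesis by (meson abs_ge_self mult_right_mono norm_ge_zero order_trans)
  qed
  then show ?thesis by (intro exI[of _ "\<bar>C\<bar>"]) auto
qed

text \<open>By \<open>slice_rel_bound\<close>, slices of a convergent sequence are Cauchy, so the
  sliceable elements form a closed set; it contains all elementary tensors.\<close>

lemma slice_rel_total: "\<exists>s. slice_rel t s"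
proof (induction t rule: dense_induct[OF mt])
  case (2 x y)
  then show ?case using slice_rel_add by blast
next
  case (3 a b)
  show ?case using slice_rel_tensor by blast
next
  case 1
  show ?case unfolding closed_sequential_limits
  proof safe
    fix t :: "nat \<Rightarrow> 'c" and l assume t: "\<forall>n. t n \<in> {t. \<exists>s. slice_rel t s}" "t \<longlonglongrightarrow> l"
    then have "\<exists>s. \<forall>n. slice_rel (t n) (s n)" by (intro choice) simp
    then obtain s where s: "\<And>n. slice_rel (t n) (s n)" by blast
    obtain C where C: "0 \<le> C" "\<And>t s. slice_rel t s \<Longrightarrow> norm s \<le> C * norm t"
      using slice_rel_bound by blast
    have "Cauchy s"
    proof (rule metric_CauchyI)
      fix e :: real assume e: "0 < e"
      have "Cauchy t" using t(2) by (rule LIMSEQ_imp_Cauchy)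
      \<comment> \<open>\<open>C + 1\<close> keeps the divisor positive when
        \<open>C = 0\<close>.\<close>
      then obtain M where M: "\<And>m n. M \<le> m \<Longrightarrow> M \<le> n \<Longrightarrow> dist (t m) (t n) < e / (C + 1)"
        using e C(1) metric_CauchyD[of t "e / (C + 1)"] by auto
      have "dist (s m) (s n) < e" if "M \<le> m" "M \<le> n" for m n
      proof -
        have "dist (s m) (s n) \<le> C * dist (t m) (t n)"
          unfolding dist_norm by (intro C slice_rel_diff s)
        also have "\<dots> \<le> C * (e / (C + 1))"
          using M[OF that] C(1) by (intro mult_left_mono) auto
        also have "\<dots> < e" using e C(1) by (simp add: field_simps)
        finally show ?thesis .
      qed
      then show "\<exists>M. \<forall>m\<ge>M. \<forall>n\<ge>M. dist (s m) (s n) < e" by blast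
    qed
    then obtain s0 where s0: "s \<longlonglongrightarrow> s0" unfolding Cauchy_convergent_iff convergent_def by blast
    have "slice_rel l s0"
      unfolding slice_rel_def
    proof (intro allI impI)
      fix f h assume f: "cfunctional f" and h: "prodfun T f g h"
      have "(\<lambda>n. h (t n)) \<longlonglongrightarrow> h l"
        by (rule bounded_linear.tendsto[OF cfunctional_bounded_linear t(2)])
          (use h in \<open>simp add: prodfun_def\<close>)
      moreover have "(\<lambda>n. f (s n)) \<longlonglongrightarrow> f s0"
        by (rule bounded_linear.tendsto[OF cfunctional_bounded_linear[OF f] s0])
      moreover have "h (t n) = f (s n)" for n using s f h by (simp add: slice_rel_def)
      ultimately show "h l = f s0" using LIMSEQ_unique by auto
    qed
    then show "\<exists>s. slice_rel l s" by blast
  qed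
qed

lemma slice_exists:
  "\<exists>S. bounded_linear S \<and> (\<forall>a b. S (T a b) = ofc (g b) * a) \<and>
     (\<forall>f h t. cfunctional f \<longrightarrow> prodfun T f g h \<longrightarrow> h t = f (S t))"
proof -
  have "\<exists>S. \<forall>t. slice_rel t (S t)" by (intro choice) (simp add: slice_rel_total)
  then obtain S where S: "\<And>t. slice_rel t (S t)" by blast
  have eq: "slice_rel t s \<Longrightarrow> S t = s" for t s using S slice_rel_unique by blast
  obtain C where C: "0 \<le> C" "\<And>t s. slice_rel t s \<Longrightarrow> norm s \<le> C * norm t"
    using slice_rel_bound by blast
  have "bounded_linear S"
    by (rule bounded_linear_intro[where K = C])
      (auto intro!: eq slice_rel_add slice_rel_scaleR S simp: mult.commute C(2)[OF S])
  moreover have "S (T a b) = ofc (g b) * a" for a b by (rule eq[OF slice_rel_tensor])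
  moreover have "h t = f (S t)" if "cfunctional f" "prodfun T f g h" for f h t
    using S that by (simp add: slice_rel_def)
  ultimately show ?thesis by blast
qed

text \<open>Slicing gives \<open>\<parallel>a\<parallel> \<le> C \<parallel>a \<otimes> 1\<parallel>\<close> for some \<open>C\<close>, and by the C*-identity the least such
  \<open>C\<close> satisfies \<open>C\<^sup>2 \<le> C\<close>.\<close>
lemma norm_le_tensor_unit:
  assumes "g 1 = 1"
  shows "norm a \<le> norm (T a 1)"
proof -
  obtain C where "\<And>t s. slice_rel t s \<Longrightarrow> norm s \<le> C * norm t"
    using slice_rel_bound by blast
  then have C: "norm a \<le> C * norm (T a 1)" for a
    using slice_rel_tensor[of a 1] assms by simp
  have sc: "T (r *\<^sub>R a) 1 = r *\<^sub>R T a 1" for r a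
    by (simp add: scaleR_ofc tensor_ofc_left[OF mt])
  define X where "X = norm ` {a. norm (T a 1) \<le> 1}"
  have "bdd_above X"
    unfolding X_def
  proof (rule bdd_aboveI2)
    fix a assume "a \<in> {a. norm (T a 1) \<le> 1}"
    then have "\<bar>C\<bar> * norm (T a 1) \<le> \<bar>C\<bar> * 1" by (intro mult_left_mono) auto
    then show "norm a \<le> \<bar>C\<bar>"
      using C[of a] by (smt (verit) mult_right_mono norm_ge_zero)
  qed
  then have up: "norm a \<le> Sup X" if "norm (T a 1) \<le> 1" for a
    using that by (auto simp: X_def intro!: cSup_upper)
  have z: "norm (T 0 1) \<le> 1" using sc[of 0 0] by simp
  have sq: "norm a \<le> sqrt (Sup X)" if "norm (T a 1) \<le> 1" for a
  proof (rule real_le_rsqrt)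
    have "T (adj a * a) 1 = adj (T a 1) * T a 1"
      using tensor_left_mult[OF mt, of "adj a" a 1] tensor_adj[OF mt, of a 1] by simp
    then have "norm (T (adj a * a) 1) \<le> 1" using that by (simp add: cstar_identity power_le_one)
    then show "(norm a)\<^sup>2 \<le> Sup X" using up[of "adj a * a"] by (simp add: cstar_identity)
  qed
  have "Sup X \<le> sqrt (Sup X)"
    using sq z by (intro cSup_least) (auto simp: X_def)
  moreover have "0 \<le> Sup X" using up[OF z] by simp
  ultimately have "(Sup X)\<^sup>2 \<le> 1 * Sup X" using real_le_rsqrt sqrt_le_D real_sqrt_pow2 by (metis mult_1 power_mono)
  then have s1: "Sup X \<le> 1" by (rule le_if_square_le_mult) simp
  show ?thesis
  proof (cases "T a 1 = 0")
    case True
    then show ?thesis using C[of a] by simp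
  next
    case False
    then have "norm ((1 / norm (T a 1)) *\<^sub>R a) \<le> 1"
      by (intro order_trans[OF up s1]) (simp add: sc)
    then show ?thesis using False by (simp add: field_simps)
  qed
qed

end

text \<open>Transfers the norm estimate to a tensor factor: \<open>T a 1\<close> is at least as
  large as \<open>a\<close>, and states pull back along this embedding.\<close>

lemma norm_le_by_states_factor:
  fixes T :: "'a::cstar \<Rightarrow> 'b::cstar \<Rightarrow> 'c::cstar"
    and f0 :: "'a \<Rightarrow> complex" and g0 :: "'b \<Rightarrow> complex"
  assumes mt: "min_tensor T" and f0: "state f0" and g0: "state g0"
    and le: "\<And>H. state H \<Longrightarrow> Re (H (adj a * a)) \<le> M"
  shows "(norm (a::'a))\<^sup>2 \<le> M"
proof -
  note sh = star_hom_tensor_unit[OF mt f0 g0]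
  have "(norm (T a 1))\<^sup>2 \<le> M"
  proof (rule norm_le_by_states[OF mt f0 g0])
    fix H :: "'c \<Rightarrow> complex" assume "state H"
    then have "state (\<lambda>a. H (T a 1))"
      using sh star_hom_bounded_linear[OF mt f0 g0 sh] by (rule state_star_hom)
    from le[OF this] show "Re (H (adj (T a 1) * T a 1)) \<le> M"
      using star_hom_mult[OF sh, of "adj a" a] star_hom_adj[OF sh, of a] by simp
  qed
  moreover have "norm a \<le> norm (T a 1)"
    by (rule norm_le_tensor_unit[OF mt, of g0]) (use g0 in \<open>auto simp: state_def\<close>)
  ultimately show ?thesis by (meson norm_ge_zero order_trans power_mono)
qed

subsection \<open>Convolution\<close>

locale idempotent_state =
  fixes T :: "'a::cstar \<Rightarrow> 'a \<Rightarrow> 'b::cstar" and Delta :: "'a \<Rightarrow> 'b"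
    and m1 :: "'b \<Rightarrow> 'a \<Rightarrow> 'c::cstar" and m2 :: "'a \<Rightarrow> 'b \<Rightarrow> 'c"
    and phi :: "'a \<Rightarrow> complex"
  assumes cqg: "compact_quantum_group T Delta m1 m2"
    and state_phi: "state phi" and conv_phi_phi: "conv T Delta phi phi = phi"
begin

abbreviation convolution (infixl "\<star>" 70) where "f \<star> g \<equiv> conv T Delta f g"

lemma
  shows mt: "min_tensor T" and m1t: "min_tensor m1" and m2t: "min_tensor m2"
    and m1_m2: "m1 (T a b) c = m2 a (T b c)"
    and star_hom_Delta: "star_hom Delta"
    and coassociative: "\<exists>D1 D2. star_hom D1 \<and> star_hom D2 \<and>
        (\<forall>a b. D1 (T a b) = m1 (Delta a) b) \<and> (\<forall>a b. D2 (T a b) = m2 a (Delta b)) \<and>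
        (\<forall>a. D1 (Delta a) = D2 (Delta a))"
    and cancellation: "closure (span {Delta a * T b 1 | a b. True}) = UNIV"
  using cqg unfolding compact_quantum_group_def by blast+

lemma phi_pos: "positive_functional phi" and phi_1: "phi 1 = 1"
  using state_phi by (auto simp: state_iff)

lemmas phi_c = posf_c[OF phi_pos]

lemma bounded_linear_Delta: "bounded_linear Delta"
  by (rule star_hom_bounded_linear[OF mt state_phi state_phi star_hom_Delta])

lemma prodfun_cfunctional: "prodfun M f g h \<Longrightarrow> cfunctional h"
  by (simp add: prodfun_def)

lemma prodfun_bounded_linear: "prodfun M f g h \<Longrightarrow> bounded_linear h"
  by (simp add: prodfun_def cfunctional_bounded_linear)

text \<open>Product functionals are unique by density, so any witness may replace the description
  operator in \<open>conv\<close>.\<close>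

lemma conv_eq: "prodfun T f g h \<Longrightarrow> (f \<star> g) a = h (Delta a)"
  unfolding conv_def
  by (rule arg_cong[of _ _ "\<lambda>h. h (Delta a)"], rule the_equality)
    (use prodfun_unique[OF mt] in blast)+

lemma conv_cfunctional:
  assumes "cfunctional f" "cfunctional g"
  shows "cfunctional (f \<star> g)"
proof -
  obtain h where h: "prodfun T f g h" using tensor_prodfun_ex[OF mt assms] by blast
  have "cfunctional (\<lambda>a. h (Delta a))"
    by (rule cfunctional_comp_bounded_linear[OF prodfun_cfunctional[OF h] bounded_linear_Delta])
      (rule star_hom_ofc[OF star_hom_Delta])
  moreover have "f \<star> g = (\<lambda>a. h (Delta a))" using conv_eq[OF h] by blast
  ultimately show ?thesis by simp
qed

lemma conv_lincomb_left:
  assumes "cfunctional f" "cfunctional f'" "cfunctional g"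
  shows "((\<lambda>a. c * f a + d * f' a) \<star> g) a = c * (f \<star> g) a + d * (f' \<star> g) a"
proof -
  obtain h h' where h: "prodfun T f g h" "prodfun T f' g h'"
    using tensor_prodfun_ex[OF mt] assms by blast
  then have "prodfun T (\<lambda>a. c * f a + d * f' a) g (\<lambda>t. c * h t + d * h' t)"
    by (simp add: prodfun_def cfunctional_lincomb algebra_simps)
  then show ?thesis using h by (simp add: conv_eq)
qed

lemma conv_lincomb_right:
  assumes "cfunctional f" "cfunctional g" "cfunctional g'"
  shows "(f \<star> (\<lambda>a. c * g a + d * g' a)) a = c * (f \<star> g) a + d * (f \<star> g') a"
proof -
  obtain h h' where h: "prodfun T f g h" "prodfun T f g' h'"
    using tensor_prodfun_ex[OF mt] assms by blast
  then have "prodfun T f (\<lambda>a. c * g a + d * g' a) (\<lambda>t. c * h t + d * h' t)"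
    by (simp add: prodfun_def cfunctional_lincomb algebra_simps)
  then show ?thesis using h by (simp add: conv_eq)
qed

text \<open>Both sides evaluate the same triple product functional at
  \<open>D1 (Delta a) = D2 (Delta a)\<close>.\<close>

lemma conv_assoc:
  assumes f: "cfunctional f" and g: "cfunctional g" and k: "cfunctional k"
  shows "f \<star> g \<star> k = f \<star> (g \<star> k)"
proof
  fix a
  obtain D1 D2 where D1: "star_hom D1" "\<And>a b. D1 (T a b) = m1 (Delta a) b"
    and D2: "star_hom D2" "\<And>a b. D2 (T a b) = m2 a (Delta b)"
    and D: "\<And>a. D1 (Delta a) = D2 (Delta a)"
    using coassociative by blast
  \<comment> \<open>Continuity of maps into the triple product requires a state on its first factor;
    \<open>phi \<otimes> phi\<close> serves.\<close>
  obtain p where p: "prodfun T phi phi p" using tensor_prodfun_ex[OF mt phi_c phi_c] by blast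
  have state_p: "state p"
    using prodfun_positive[OF mt phi_pos phi_pos p] prodfun_tensor[OF mt p, of 1 1]
    by (simp add: state_iff tensor_1_1[OF mt] phi_1)
  have bl1: "bounded_linear D1"
    by (rule star_hom_bounded_linear[OF m1t state_p state_phi D1(1)])
  have bl2: "bounded_linear D2"
    by (rule star_hom_bounded_linear[OF m1t state_p state_phi D2(1)])
  obtain hfg where hfg: "prodfun T f g hfg" using tensor_prodfun_ex[OF mt f g] by blast
  obtain hgk where hgk: "prodfun T g k hgk" using tensor_prodfun_ex[OF mt g k] by blast
  obtain H1 where H1: "prodfun m1 hfg k H1"
    using tensor_prodfun_ex[OF m1t prodfun_cfunctional[OF hfg] k] by blast
  obtain H2 where H2: "prodfun m2 f hgk H2"
    using tensor_prodfun_ex[OF m2t f prodfun_cfunctional[OF hgk]] by blast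
  \<comment> \<open>Continuity in the first leg follows from
    \<open>m1 t c = m1 t 1 * m1 1 c\<close>.\<close>
  have bl_m1: "bounded_linear (\<lambda>t. m1 t c)" for c
  proof -
    have "bounded_linear (\<lambda>t. m1 t 1 * m1 1 c)"
      using star_hom_bounded_linear[OF m1t state_p state_phi star_hom_tensor_unit[OF m1t state_p state_phi]]
      by (rule bounded_linear_mult_const)
    then show ?thesis by (simp flip: tensor_mult[OF m1t])
  qed
  have "H1 x = H2 x" for x
  proof (rule dense_eq[OF m1t prodfun_bounded_linear[OF H1] prodfun_bounded_linear[OF H2]])
    fix t c
    show "H1 (m1 t c) = H2 (m1 t c)"
    proof (rule dense_eq[OF mt])
      show "bounded_linear (\<lambda>t. H1 (m1 t c))" "bounded_linear (\<lambda>t. H2 (m1 t c))"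
        using prodfun_bounded_linear[OF H1] prodfun_bounded_linear[OF H2] bl_m1[of c]
        by (auto intro: bounded_linear_compose)
      show "H1 (m1 (T a b) c) = H2 (m1 (T a b) c)" for a b
        using prodfun_tensor[OF m1t H1, of "T a b" c] prodfun_tensor[OF m2t H2, of a "T b c"]
          prodfun_tensor[OF mt hfg] prodfun_tensor[OF mt hgk] by (simp add: m1_m2)
    qed
  qed
  moreover have "(f \<star> g \<star> k) a = H1 (D1 (Delta a))"
  proof -
    obtain h where h: "prodfun T (f \<star> g) k h"
      using tensor_prodfun_ex[OF mt conv_cfunctional[OF f g] k] by blast
    have "h t = H1 (D1 t)" for t
    proof (rule dense_eq[OF mt prodfun_bounded_linear[OF h]])
      show "bounded_linear (\<lambda>t. H1 (D1 t))"
        using prodfun_bounded_linear[OF H1] bl1 by (rule bounded_linear_compose)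
      show "h (T a b) = H1 (D1 (T a b))" for a b
        by (simp add: D1(2) prodfun_tensor[OF mt h] prodfun_tensor[OF m1t H1] conv_eq[OF hfg])
    qed
    then show ?thesis by (simp add: conv_eq[OF h])
  qed
  moreover have "(f \<star> (g \<star> k)) a = H2 (D2 (Delta a))"
  proof -
    obtain h where h: "prodfun T f (g \<star> k) h"
      using tensor_prodfun_ex[OF mt f conv_cfunctional[OF g k]] by blast
    have "h t = H2 (D2 t)" for t
    proof (rule dense_eq[OF mt prodfun_bounded_linear[OF h]])
      show "bounded_linear (\<lambda>t. H2 (D2 t))"
        using prodfun_bounded_linear[OF H2] bl2 by (rule bounded_linear_compose)
      show "h (T a b) = H2 (D2 (T a b))" for a b
        by (simp add: D2(2) prodfun_tensor[OF mt h] prodfun_tensor[OF m2t H2] conv_eq[OF hgk])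
    qed
    then show ?thesis by (simp add: conv_eq[OF h])
  qed
  ultimately show "(f \<star> g \<star> k) a = (f \<star> (g \<star> k)) a" by (simp add: D)
qed

text \<open>Translates convolutions of \<open>f (c * _)\<close> and \<open>g (d * _)\<close> into
  left multiplication by \<open>T c d\<close>.\<close>

lemma prodfun_mult_left:
  assumes "prodfun T f g h"
  shows "prodfun T (\<lambda>a. f (c * a)) (\<lambda>b. g (d * b)) (\<lambda>t. h (T c d * t))"
  using assms cfunctional_mult_left[of h "T c d"]
  by (simp add: prodfun_def flip: tensor_mult[OF mt])

end

subsection \<open>The conditional expectation of an idempotent state\<close>

text \<open>\<open>S\<close> is the slice map \<open>\<iota> \<otimes> \<phi>\<close>.\<close>
locale idempotent_state_slice = idempotent_state T Delta m1 m2 phi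
  for T :: "'a::cstar \<Rightarrow> 'a \<Rightarrow> 'b::cstar" and Delta :: "'a \<Rightarrow> 'b"
    and m1 :: "'b \<Rightarrow> 'a \<Rightarrow> 'c::cstar" and m2 :: "'a \<Rightarrow> 'b \<Rightarrow> 'c"
    and phi :: "'a \<Rightarrow> complex" +
  fixes S :: "'b \<Rightarrow> 'a"
  assumes bounded_linear_S: "bounded_linear S"
    and S_tensor: "S (T a b) = ofc (phi b) * a"
    and prodfun_S: "cfunctional f \<Longrightarrow> prodfun T f phi h \<Longrightarrow> h t = f (S t)"
begin

definition R :: "'a \<Rightarrow> 'a" where "R a = S (Delta a)"

lemma bounded_linear_R: "bounded_linear R"
  unfolding R_def[abs_def] using bounded_linear_S bounded_linear_Delta by (rule bounded_linear_compose)

lemma conv_phi: "cfunctional f \<Longrightarrow> (f \<star> phi) a = f (R a)"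
  using tensor_prodfun_ex[OF mt _ phi_c, of f] prodfun_S conv_eq unfolding R_def by metis

lemma phi_R: "phi (R a) = phi a"
  using conv_phi[OF phi_c, of a] by (simp add: conv_phi_phi)

text \<open>Under a functional, \<open>R\<close> is right convolution with \<open>phi\<close>, so
  associativity and idempotence apply.\<close>

lemma R_R: "R (R a) = R a"
proof (rule cfunctional_separate)
  fix f :: "'a \<Rightarrow> complex" assume f: "cfunctional f"
  have "f (R (R a)) = ((f \<star> phi) \<star> phi) a"
    using f conv_phi conv_cfunctional[OF f phi_c] by metis
  also have "\<dots> = f (R a)" by (simp add: conv_assoc f phi_c conv_phi_phi conv_phi)
  finally show "f (R (R a)) = f (R a)" .
qed

text \<open>Evaluation at \<open>R y\<close> is a further convolution with \<open>phi\<close>, which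
  associativity moves onto \<open>g\<close>.\<close>

lemma conv_R:
  assumes "cfunctional f" "cfunctional g"
  shows "(f \<star> g) (R y) = (f \<star> (\<lambda>a. g (R a))) y"
proof -
  have "(f \<star> g) (R y) = (f \<star> (g \<star> phi)) y"
    using assms by (simp add: conv_cfunctional phi_c flip: conv_phi conv_assoc)
  moreover have "g \<star> phi = (\<lambda>a. g (R a))" using conv_phi[OF assms(2)] by blast
  ultimately show ?thesis by simp
qed

lemma R_1: "R 1 = 1"
  using S_tensor[of 1 1] by (simp add: R_def star_hom_1[OF star_hom_Delta] tensor_1_1[OF mt] phi_1)

lemma S_adj: "S (adj t) = adj (S t)"
proof (rule dense_eq[OF mt])
  show "bounded_linear (\<lambda>t. S (adj t))" "bounded_linear (\<lambda>t. adj (S t))"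
    using bounded_linear_S bounded_linear_adj by (auto intro: bounded_linear_compose)
  show "S (adj (T a b)) = adj (S (T a b))" for a b
    by (simp add: tensor_adj[OF mt] S_tensor adj_ofc posf_adj[OF phi_pos])
qed

lemma R_adj: "R (adj a) = adj (R a)"
  by (simp add: R_def S_adj star_hom_adj[OF star_hom_Delta])

lemma S_module: "S (T c 1 * t) = c * S t"
proof (rule dense_eq[OF mt])
  show "bounded_linear (\<lambda>t. S (T c 1 * t))"
    by (rule bounded_linear_compose[OF bounded_linear_S bounded_linear_mult_right])
  show "bounded_linear (\<lambda>t. c * S t)"
    by (rule bounded_linear_compose[OF bounded_linear_mult_right bounded_linear_S])
  show "S (T c 1 * T a b) = c * S (T a b)" for a b
    by (simp add: S_tensor mult_ofc flip: tensor_mult[OF mt])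
qed

text \<open>\<open>f\<close> composed with \<open>R\<close> is the positive functional
  \<open>f \<otimes> phi\<close> composed with \<open>Delta\<close>.\<close>

lemma R_positive:
  assumes f: "positive_functional f"
  shows "cnonneg (f (R (adj x * x)))"
proof -
  obtain h where h: "prodfun T f phi h" using tensor_prodfun_ex[OF mt posf_c[OF f] phi_c] by blast
  have "f (R (adj x * x)) = h (adj (Delta x) * Delta x)"
    unfolding R_def
    by (simp add: prodfun_S[OF posf_c[OF f] h] star_hom_mult[OF star_hom_Delta] star_hom_adj[OF star_hom_Delta])
  then show ?thesis
    using posf_nn[OF prodfun_positive[OF mt f phi_pos h]] by simp
qed

text \<open>For \<open>b = R y\<close> the element \<open>\<Delta>(b) - b \<otimes> 1\<close> is null for \<open>\<phi> \<otimes> \<phi>\<close>; the density of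
  \<open>(A \<otimes> 1)\<Delta>(A)\<close> turns this into multiplicativity of \<open>\<phi>\<close>.\<close>
lemma phi_multiplicative: "phi (d * R y) = phi d * phi y"
proof -
  obtain H where H: "prodfun T phi phi H" using tensor_prodfun_ex[OF mt phi_c phi_c] by blast
  note pH = prodfun_positive[OF mt phi_pos phi_pos H]
  note Hc = posf_c[OF pH]
  have HS: "H t = phi (S t)" for t by (rule prodfun_S[OF phi_c H])
  have null: "H (Z * Delta (R y)) = H (Z * T (R y) 1)" for Z y
  proof -
    define b where "b = R y"
    define X where "X = Delta b - T b 1"
    have Rb: "R b = b" by (simp add: b_def R_R)
    \<comment> \<open>The four terms of \<open>H (adj X * X)\<close> all equal
      \<open>phi (adj b * b)\<close> and cancel.\<close>
    have 1: "H (Delta (adj b * b)) = phi (adj b * b)" using phi_R by (simp add: HS flip: R_def)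
    have 2: "H (T (adj b) 1 * Delta b) = phi (adj b * b)"
      using Rb by (simp add: HS S_module flip: R_def)
    have 3: "H (adj (Delta b) * T b 1) = phi (adj b * b)"
      using posf_hermitian2[OF pH, of "Delta b" "T b 1"] 2 posf_adj[OF phi_pos, of "adj b * b"]
      by (simp add: tensor_adj[OF mt] adj_mult adj_adj)
    have 4: "H (T (adj b) 1 * T b 1) = phi (adj b * b)"
      using prodfun_tensor[OF mt H, of "adj b * b" 1] by (simp add: phi_1 flip: tensor_mult[OF mt])
    have "H (adj X * X) = 0"
      using 1 2 3 4
      by (simp add: X_def adj_diff tensor_adj[OF mt] algebra_simps cfunctional_diff[OF Hc]
          cfunctional_add[OF Hc] star_hom_mult[OF star_hom_Delta] star_hom_adj[OF star_hom_Delta])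
    then have "H (Z * X) = 0" by (rule posf_null[OF pH])
    then show ?thesis by (simp add: X_def b_def right_diff_distrib cfunctional_diff[OF Hc])
  qed
  let ?k = "\<lambda>a. phi (d * R a)"
  have k: "cfunctional ?k"
  proof -
    have "(\<lambda>a. phi (d * a)) \<star> phi = ?k"
      using conv_phi[OF cfunctional_mult_left[OF phi_c, of d]] by blast
    then show ?thesis using conv_cfunctional[OF cfunctional_mult_left[OF phi_c, of d] phi_c] by simp
  qed
  \<comment> \<open>By \<open>null\<close>, \<open>Delta (R y)\<close> may be replaced by
    \<open>T (R y) 1\<close> under \<open>H\<close>, which separates \<open>d\<close> from
    \<open>y\<close>.\<close>
  have key: "((\<lambda>a. phi (c * a)) \<star> ?k) y = phi d * ((\<lambda>a. phi (c * a)) \<star> phi) y" for c y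
  proof -
    have "((\<lambda>a. phi (c * a)) \<star> ?k) y = ((\<lambda>a. phi (c * a)) \<star> (\<lambda>a. phi (d * a))) (R y)"
      by (simp add: conv_R cfunctional_mult_left phi_c)
    also have "\<dots> = H (T c d * Delta (R y))" by (rule conv_eq[OF prodfun_mult_left[OF H]])
    also have "\<dots> = H (T (c * R y) d)" using tensor_mult[OF mt, of c "R y" d 1] by (simp add: null)
    also have "\<dots> = phi d * phi (c * R y)" by (simp add: prodfun_tensor[OF mt H])
    finally show ?thesis by (simp add: conv_phi cfunctional_mult_left phi_c)
  qed
  \<comment> \<open>The defect of multiplicativity as a functional of \<open>y\<close>; the aim is
    that it vanishes.\<close>
  let ?k' = "\<lambda>a. 1 * ?k a + (- phi d) * phi a"
  have k': "cfunctional ?k'" by (rule cfunctional_lincomb[OF k phi_c])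
  obtain G where G: "prodfun T phi ?k' G" using tensor_prodfun_ex[OF mt phi_c k'] by blast
  have G0: "G (T c 1 * Delta y) = 0" for c y
  proof -
    have "G (T c 1 * Delta y) = ((\<lambda>a. phi (c * a)) \<star> ?k') y"
      using conv_eq[OF prodfun_mult_left[OF G, of c 1], of y] by simp
    also have "\<dots> = 0"
      by (subst conv_lincomb_right[OF cfunctional_mult_left[OF phi_c] k phi_c]) (simp add: key)
    finally show ?thesis .
  qed
  \<comment> \<open>The adjoint turns the products \<open>T c 1 * Delta y\<close>, killed by
    \<open>G\<close>, into those of the density condition.\<close>
  have blG: "bounded_linear (\<lambda>t. G (adj t))"
    using prodfun_bounded_linear[OF G] bounded_linear_adj by (rule bounded_linear_compose)
  have "closure (span {Delta a * T b 1 | a b. True}) \<subseteq> {t. G (adj t) = 0}"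
  proof (rule closure_minimal)
    have "subspace {t. G (adj t) = 0}"
      using bounded_linear.linear[OF blG] by (rule linear_subspace_kernel)
    then show "span {Delta a * T b 1 | a b. True} \<subseteq> {t. G (adj t) = 0}"
      by (rule span_minimal[rotated])
        (auto simp: adj_mult tensor_adj[OF mt] G0 simp flip: star_hom_adj[OF star_hom_Delta])
    show "closed {t. G (adj t) = 0}"
      by (intro closed_Collect_eq linear_continuous_on blG continuous_on_const)
  qed
  then have "G (adj (adj (T 1 y))) = 0" using cancellation by blast
  then show ?thesis using prodfun_tensor[OF mt G, of 1 y] by (simp add: adj_adj phi_1)
qed

text \<open>The module property of a conditional expectation. Multiplicativity of \<open>phi\<close>
  in the second leg gives it with an elementary tensor in place of \<open>Delta a\<close>; density
  does the rest.\<close>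

lemma R_mult_R: "R (a * R y) = R a * R y"
proof (rule cfunctional_separate)
  fix f :: "'a \<Rightarrow> complex" assume f: "cfunctional f"
  obtain F where F: "prodfun T f phi F" using tensor_prodfun_ex[OF mt f phi_c] by blast
  have "F (Z * Delta (R y)) = f (S Z * R y)" for Z
  proof (rule dense_eq[OF mt])
    show "bounded_linear (\<lambda>Z. F (Z * Delta (R y)))"
      by (rule bounded_linear_compose[OF prodfun_bounded_linear[OF F] bounded_linear_mult_left])
    show "bounded_linear (\<lambda>Z. f (S Z * R y))"
      by (rule bounded_linear_compose[OF cfunctional_bounded_linear[OF f]
            bounded_linear_mult_const[OF bounded_linear_S]])
    fix c d
    note cf = cfunctional_mult_left[OF f, of c] and cp = cfunctional_mult_left[OF phi_c, of d]
    have "F (T c d * Delta (R y)) = ((\<lambda>a. f (c * a)) \<star> (\<lambda>a. phi (d * a))) (R y)"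
      by (rule conv_eq[OF prodfun_mult_left[OF F], symmetric])
    \<comment> \<open>The zero summand matches the form of
      \<open>conv_lincomb_right\<close>.\<close>
    also have "\<dots> = ((\<lambda>a. f (c * a)) \<star> (\<lambda>a. phi d * phi a + 0 * phi a)) y"
      by (simp add: conv_R[OF cf cp] phi_multiplicative)
    also have "\<dots> = phi d * f (c * R y)"
      by (subst conv_lincomb_right[OF cf phi_c phi_c]) (simp add: conv_phi[OF cf])
    finally show "F (T c d * Delta (R y)) = f (S (T c d) * R y)"
      by (simp add: S_tensor mult.assoc cfunctional_ofc[OF f])
  qed
  from this[of "Delta a"] show "f (R (a * R y)) = f (R a * R y)"
    unfolding R_def by (simp add: prodfun_S[OF f F] flip: star_hom_mult[OF star_hom_Delta])
qed

lemma
  assumes "R b = b"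
  shows R_mult_right: "R (a * b) = R a * b" and R_mult_left: "R (b * a) = b * R a"
proof -
  have *: "R (a * b) = R a * b" if "R b = b" for a b using R_mult_R[of a b] that by simp
  from assms show "R (a * b) = R a * b" by (rule *)
  have "R (adj (b * a)) = adj (b * R a)"
    using *[of "adj b" "adj a"] assms by (simp add: adj_mult R_adj)
  then show "R (b * a) = b * R a" by (metis R_adj adj_adj)
qed

end

text \<open>The inverse solves \<open>(1 + M) v = 1 + (M - w) v\<close> with \<open>M = \<parallel>w\<parallel>\<close>; positivity enters through
  \<open>\<parallel>M - w\<parallel> \<le> M\<close>, which makes the right-hand side contract.\<close>
lemma positive_inverse:
  fixes T :: "'a::cstar \<Rightarrow> 'b::cstar \<Rightarrow> 'c::cstar" and f0 :: "'a \<Rightarrow> complex" and g0 :: "'b \<Rightarrow> complex"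
    and w :: 'a
  assumes mt: "min_tensor T" and f0: "state f0" and g0: "state g0"
    and B: "subspace B" "closed B" "1 \<in> B" "\<And>x y. x \<in> B \<Longrightarrow> y \<in> B \<Longrightarrow> x * y \<in> B"
    and w: "w \<in> B" "adj w = w" and pos: "\<And>f. positive_functional f \<Longrightarrow> cnonneg (f w)"
  obtains v where "v \<in> B" "adj v = v" "v * (1 + w) = 1" "(1 + w) * v = 1" "norm v \<le> 1"
proof -
  define M where "M = norm w"
  define W where "W = M *\<^sub>R 1 - w"
  have M: "0 \<le> M" by (simp add: M_def)
  have adjW: "adj W = W" by (simp add: W_def adj_diff adj_scaleR w)
  have "(norm W)\<^sup>2 \<le> M\<^sup>2"
  proof (rule norm_le_by_states_factor[OF mt f0 g0])
    fix H :: "'a \<Rightarrow> complex" assume H: "state H"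
    then have pH: "positive_functional H" and H1: "H 1 = 1" by (auto simp: state_iff)
    note Hs = cfunctional_simps[OF posf_c[OF pH]]
    have HW: "Re (H W) \<le> M" using pos[OF pH] by (simp add: W_def Hs H1 cnonneg_def)
    have posW: "0 \<le> Re (H (adj d * W * d))" for d
    proof -
      have "Re (H (adj d * w * d)) \<le> Re (H (adj d * 1 * d)) * M"
        using posf_bound[OF posf_compress[OF pH, of d], of w] complex_Re_le_cmod order_trans
        by (simp add: M_def) blast
      then show ?thesis by (simp add: W_def algebra_simps Hs)
    qed
    have posw: "0 \<le> Re (H (adj d * w * d))" for d
      using pos[OF posf_compress[OF pH, of d]] by (simp add: cnonneg_def)
    \<comment> \<open>Since \<open>W\<close> and \<open>w\<close> commute with sum \<open>M\<close>,
      this writes \<open>M W w\<close> as a sum of two terms with nonnegative real part under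
      \<open>H\<close>.\<close>
    have "M *\<^sub>R (W * w) = adj W * w * W + adj w * W * w"
      by (simp add: adjW w(2)) (simp add: W_def algebra_simps)
    from arg_cong[OF this, of H]
    have "of_real M * H (W * w) = H (adj W * w * W) + H (adj w * W * w)" by (simp only: Hs)
    from arg_cong[OF this, of Re]
    have "0 \<le> M * Re (H (W * w))" using posw[of W] posW[of w] by simp
    then have Ww: "0 \<le> Re (H (W * w))"
    proof (cases "M = 0")
      case True
      then have "w = 0" by (simp add: M_def)
      then show ?thesis by (simp add: Hs)
    qed (use M in \<open>simp add: zero_le_mult_iff\<close>)
    have "adj W * W = M *\<^sub>R W - W * w" by (simp add: adjW) (simp add: W_def algebra_simps)
    then have "Re (H (adj W * W)) = M * Re (H W) - Re (H (W * w))" by (simp add: Hs)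
    also have "\<dots> \<le> M * M" using mult_left_mono[OF HW M] Ww by linarith
    finally show "Re (H (adj W * W)) \<le> M\<^sup>2" by (simp add: power2_eq_square)
  qed
  then have nW: "norm W \<le> M" by (rule power2_le_imp_le) (rule M)
  \<comment> \<open>Iterating inside \<open>B\<close> places the inverse in
    \<open>B\<close>.\<close>
  define X where "X = {v \<in> B. norm v \<le> 1}"
  define F where "F v = (1 / (1 + M)) *\<^sub>R (1 + W * v)" for v
  have WB: "W \<in> B" unfolding W_def using B w by (intro subspace_diff subspace_scale) auto
  have "closed X"
  proof -
    have "X = B \<inter> cball 0 1" by (auto simp: X_def)
    then show ?thesis using B(2) by auto
  qed
  then have "complete X" by (simp add: complete_eq_closed)
  moreover have "0 \<in> X" using subspace_0[OF B(1)] by (simp add: X_def)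
  then have "X \<noteq> {}" by blast
  moreover have "F ` X \<subseteq> X"
  proof safe
    fix v assume v: "v \<in> X"
    have "norm (W * v) \<le> M * 1"
      using v nW by (intro order_trans[OF norm_mult_ineq] mult_mono) (auto simp: X_def M)
    then have "norm (1 + W * v) \<le> 1 + M" using norm_triangle_ineq[of 1 "W * v"] by simp
    moreover have "F v \<in> B"
      unfolding F_def using v WB B by (intro subspace_scale subspace_add) (auto simp: X_def)
    ultimately show "F v \<in> X" using M by (simp add: X_def F_def)
  qed
  moreover have "dist (F x) (F y) \<le> M / (1 + M) * dist x y" for x y
  proof -
    have "F x - F y = (1 / (1 + M)) *\<^sub>R (W * (x - y))"
      by (simp add: F_def right_diff_distrib flip: scaleR_diff_right)
    moreover have "norm (W * (x - y)) \<le> M * norm (x - y)"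
      using nW by (intro order_trans[OF norm_mult_ineq] mult_right_mono) auto
    ultimately show ?thesis using M by (simp add: dist_norm divide_right_mono)
  qed
  ultimately have "\<exists>!v. v \<in> X \<and> F v = v"
    using M by (intro Banach_fix[where c = "M / (1 + M)"]) auto
  then obtain v where v: "v \<in> X" "F v = v" by blast
  have "(1 + M) *\<^sub>R v = (1 + M) *\<^sub>R F v" by (simp only: v(2))
  also have "\<dots> = 1 + W * v" using M by (simp add: F_def)
  finally have r: "(1 + w) * v = 1" by (simp add: W_def algebra_simps)
  \<comment> \<open>The adjoint of a right inverse of \<open>1 + w\<close> is a left inverse, so the
    two coincide.\<close>
  have "adj v * (1 + w) = 1"
    using arg_cong[OF r, of adj] unfolding adj_mult adj_add w(2) adj_1 .
  then have "adj v = v" using r by (metis mult.assoc mult_1 mult.right_neutral)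
  with r \<open>adj v * (1 + w) = 1\<close> v(1) show thesis by (intro that[of v]) (auto simp: X_def)
qed

subsection \<open>Conditionally positive functionals\<close>

context idempotent_state_slice
begin

text \<open>By \<open>R_R\<close> this is the range of \<open>R\<close>; as a fixed-point set it is
  visibly closed.\<close>

definition B :: "'a set" where "B = {b. R b = b}"

lemma B_subspace: "subspace B"
proof -
  interpret bounded_linear R by (rule bounded_linear_R)
  show ?thesis by (auto simp: B_def subspace_def zero add scaleR)
qed

lemma B_closed: "closed B"
  unfolding B_def by (intro closed_Collect_eq linear_continuous_on bounded_linear_R continuous_on_id)

lemma B_1: "1 \<in> B" by (simp add: B_def R_1)

lemma B_mult: "x \<in> B \<Longrightarrow> y \<in> B \<Longrightarrow> x * y \<in> B"
  by (simp add: B_def R_mult_right)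

lemma phi_mult_B: "b \<in> B \<Longrightarrow> phi (a * b) = phi a * phi b"
  using phi_multiplicative[of a b] by (simp add: B_def)

lemma B_positive_inverse:
  assumes "w \<in> B" "adj w = w" "\<And>f. positive_functional f \<Longrightarrow> cnonneg (f w)"
  obtains v where "v \<in> B" "adj v = v" "v * (1 + w) = 1" "(1 + w) * v = 1" "norm v \<le> 1"
  by (rule positive_inverse[OF mt state_phi state_phi B_subspace B_closed B_1 _ assms(1,2)])
    (rule B_mult assms(3) that; assumption)+

context
  fixes u :: "'a \<Rightarrow> complex"
  assumes u: "cfunctional u"
    and cond_pos: "\<And>x. phi (adj x * x) = 0 \<Longrightarrow> cnonneg (u (adj x * x))"
begin

text \<open>By Cauchy--Schwarz, combinations of \<open>phi\<close>-null vectors are null, so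
  polarization applies to \<open>u\<close> on them.\<close>

lemma conditionally_positive_hermitian:
  assumes x: "phi (adj x * x) = 0" and y: "phi (adj y * y) = 0"
  shows "u (adj y * x) = cnj (u (adj x * y))"
proof (rule hermitian_on_polarization[OF u])
  fix c d
  have "phi (adj (ofc c * x + ofc d * y) * (ofc c * x + ofc d * y)) = 0"
    by (simp add: cfunctional_sesquilinear[OF phi_c] x y posf_null[OF phi_pos x] posf_null[OF phi_pos y])
  from cond_pos[OF this]
  show "Im (u (adj (ofc c * x + ofc d * y) * (ofc c * x + ofc d * y))) = 0"
    by (simp add: cnonneg_def)
qed

text \<open>With \<open>v = (1 + k\<^sup>2 / e)\<^sup>-\<^sup>1\<close> we have \<open>k = k (k v k) / e + v k\<close>, where \<open>u\<close> is real on the first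
  summand and the second one is of norm at most \<open>\<surd>(2 e)\<close>.\<close>
lemma conditionally_positive_real:
  assumes k: "k \<in> B" "adj k = k" "phi k = 0"
  shows "Im (u k) = 0"
proof -
  obtain K where K: "0 \<le> K" "\<And>a. cmod (u a) \<le> norm a * K"
    using bounded_linear.nonneg_bounded[OF cfunctional_bounded_linear[OF u]] by blast
  have est: "(Im (u k))\<^sup>2 \<le> 2 * e * K\<^sup>2" if e: "0 < e" for e :: real
  proof -
    define w where "w = (1 / e) *\<^sub>R (k * k)"
    have wB: "w \<in> B" unfolding w_def by (intro subspace_scale[OF B_subspace] B_mult k)
    have aw: "adj w = w" by (simp add: w_def adj_scaleR adj_mult k)
    have "cnonneg (f w)" if "positive_functional f" for f
      using posf_nn[OF that, of k] e cnonneg_scale[of "1 / e"]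
      by (simp add: w_def k(2) cfunctional_scaleR[OF posf_c[OF that]])
    with wB aw obtain v where v: "v \<in> B" "adj v = v" "v * (1 + w) = 1" "(1 + w) * v = 1" "norm v \<le> 1"
      by (rule B_positive_inverse)
    have kw: "k * (1 + w) = (1 + w) * k" by (simp add: w_def algebra_simps)
    have vk: "v * k = k * v"
    proof -
      have "v * k = v * (k * (1 + w)) * v" using v(4) by (simp add: mult.assoc)
      also have "\<dots> = k * v" unfolding kw using v(3) by (simp flip: mult.assoc)
      finally show ?thesis .
    qed
    have vk': "v * (k * a) = k * (v * a)" for a using vk by (metis mult.assoc)
    have kk: "k * k = e *\<^sub>R w" using e by (simp add: w_def)
    have vw: "v * w = 1 - v" using v(3) by (simp add: algebra_simps eq_diff_eq)
    have wv: "w * v = 1 - v" using v(4) by (simp add: algebra_simps eq_diff_eq)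
    \<comment> \<open>Both \<open>k\<close> and \<open>?z\<close> are \<open>phi\<close>-null and
      \<open>k * ?z\<close> is selfadjoint, so hermiticity makes \<open>u (k * ?z)\<close>
      real.\<close>
    let ?z = "k * (v * k)"
    have "phi (adj k * k) = 0" by (simp add: phi_mult_B k)
    moreover have "phi (adj ?z * ?z) = 0" by (simp add: phi_mult_B B_mult k v)
    ultimately have "u (adj ?z * k) = cnj (u (adj k * ?z))" by (rule conditionally_positive_hermitian)
    moreover have "adj ?z * k = adj k * ?z" by (simp add: adj_mult k v vk vk' mult.assoc)
    ultimately have real: "Im (u (k * ?z)) = 0" by (simp add: k(2) complex_eq_iff)
    have "k * ?z = e *\<^sub>R ((w * v) * k)" using kk by (simp flip: mult.assoc)
    then have "(1 / e) *\<^sub>R (k * ?z) = w * v * k" using e by simp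
    then have "k = (1 / e) *\<^sub>R (k * ?z) + v * k" by (simp add: wv left_diff_distrib)
    then have "u k = of_real (1 / e) * u (k * ?z) + u (v * k)"
      by (metis cfunctional_add[OF u] cfunctional_scaleR[OF u])
    then have "Im (u k) = Im (u (v * k))" using real by simp
    then have "\<bar>Im (u k)\<bar> \<le> norm (v * k) * K" using K(2)[of "v * k"] abs_Im_le_cmod order_trans by metis
    then have "(Im (u k))\<^sup>2 \<le> (norm (v * k) * K)\<^sup>2"
      using power_mono[of "\<bar>Im (u k)\<bar>" _ 2] by simp
    \<comment> \<open>By the C*-identity and commutation the square is the norm of
      \<open>v k k v\<close>, where \<open>k k = e w\<close> and \<open>w v = 1 - v\<close>.\<close>
    also have "(norm (v * k))\<^sup>2 = norm (v * (e *\<^sub>R (1 - v)))"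
    proof -
      have "adj (v * k) * (v * k) = k * (v * k) * v" by (simp add: adj_mult k v vk vk' mult.assoc)
      also have "\<dots> = v * (k * k) * v" by (simp add: vk vk' mult.assoc)
      also have "\<dots> = v * (e *\<^sub>R (1 - v))" by (simp add: kk wv mult.assoc)
      finally show ?thesis by (metis cstar_identity)
    qed
    then have "(norm (v * k) * K)\<^sup>2 = norm (v * (e *\<^sub>R (1 - v))) * K\<^sup>2" by (simp add: power_mult_distrib)
    also have "norm (v * (e *\<^sub>R (1 - v))) \<le> 1 * (e * 2)"
    proof (intro order_trans[OF norm_mult_ineq] mult_mono v)
      show "norm (e *\<^sub>R (1 - v)) \<le> e * 2" using norm_triangle_ineq4[of 1 v] v(5) e by simp
    qed auto
    finally show ?thesis by (simp add: mult_right_mono mult.commute)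
  qed
  have "(Im (u k))\<^sup>2 \<le> 0"
  proof (rule field_le_epsilon)
    fix d :: real assume d: "0 < d"
    \<comment> \<open>The added 1 keeps the divisor positive when \<open>K = 0\<close>.\<close>
    have q: "0 < 2 * K\<^sup>2 + 1" by (simp add: add_nonneg_pos)
    have "(Im (u k))\<^sup>2 \<le> 2 * (d / (2 * K\<^sup>2 + 1)) * K\<^sup>2" using d q by (intro est) simp
    also have "\<dots> \<le> d" using d q by (simp add: pos_divide_le_eq algebra_simps)
    finally show "(Im (u k))\<^sup>2 \<le> 0 + d" by simp
  qed
  then show ?thesis by simp
qed

text \<open>With \<open>w = R (x\<^sup>* x) / \<phi> (x\<^sup>* x)\<close> and the Cayley transform \<open>y = (w - 1) (w + 1)\<^sup>-\<^sup>1\<close> we have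
  \<open>w - 1 = y w y + y\<^sup>2 + 2 y\<close>. Conditional positivity applies to the first two summands and
  \<open>\<parallel>y\<parallel> \<le> 3\<close>.\<close>
lemma conditionally_positive_bound:
  assumes u1: "u 1 = 0" and uR: "\<And>a. u (R a) = u a"
    and K: "\<And>a. cmod (u a) \<le> K * norm a"
  shows "Im (u (adj x * x)) = 0 \<and> - (6 * K) * Re (phi (adj x * x)) \<le> Re (u (adj x * x))"
proof (cases "phi (adj x * x) = 0")
  case True
  then show ?thesis using cond_pos[OF True] by (simp add: cnonneg_def)
next
  case False
  define l where "l = Re (phi (adj x * x))"
  have l: "phi (adj x * x) = of_real l" "0 < l"
    using posf_nn[OF phi_pos, of x] False by (auto simp: l_def cnonneg_def complex_eq_iff)
  note us = cfunctional_simps[OF u] and ps = cfunctional_simps[OF phi_c]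
  define w where "w = (1 / l) *\<^sub>R R (adj x * x)"
  have Rw: "R (adj x * x) = l *\<^sub>R w" using l by (simp add: w_def)
  have wB: "w \<in> B" unfolding w_def by (intro subspace_scale[OF B_subspace]) (simp add: B_def R_R)
  have aw: "adj w = w" by (simp add: w_def adj_scaleR adj_mult adj_adj flip: R_adj)
  have pw: "phi w = 1" using l by (simp add: w_def ps phi_R flip: of_real_mult)
  have "cnonneg (f w)" if "positive_functional f" for f
    using R_positive[OF that, of x] l cnonneg_scale[of "1 / l"]
    by (simp add: w_def cfunctional_scaleR[OF posf_c[OF that]])
  with wB aw obtain v where v: "v \<in> B" "adj v = v" "v * (1 + w) = 1" "(1 + w) * v = 1" "norm v \<le> 1"
    by (rule B_positive_inverse)
  have vw: "v * w = 1 - v" using v(3) by (simp add: algebra_simps eq_diff_eq)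
  have wv: "w * v = 1 - v" using v(4) by (simp add: algebra_simps eq_diff_eq)
  \<comment> \<open>Equals \<open>(w - 1) v\<close>, because \<open>(w + 1) v = 1\<close>.\<close>
  define y where "y = 1 - (v + v)"
  have yB: "y \<in> B" unfolding y_def
    by (intro subspace_diff[OF B_subspace] subspace_add[OF B_subspace] B_1 v)
  have ay: "adj y = y" by (simp add: y_def adj_diff adj_add v)
  \<comment> \<open>Since \<open>phi\<close> is a character on \<open>B\<close> and
    \<open>phi w = 1\<close>, \<open>phi v = 1/2\<close>, whence \<open>phi y = 0\<close>.\<close>
  have "phi (v * (1 + w)) = phi v * phi (1 + w)"
    by (intro phi_mult_B subspace_add[OF B_subspace] B_1 wB)
  then have "phi v * 2 = 1" using v(3) by (simp add: ps pw phi_1)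
  then have "phi v + phi v = 1" by (simp add: mult_2_right)
  then have py: "phi y = 0" by (simp only: y_def ps phi_1 diff_self)
  have ny: "norm y \<le> 3"
    using norm_triangle_ineq4[of 1 "v + v"] norm_triangle_ineq[of v v] v(5) by (simp add: y_def)
  have n1: "0 \<le> Re (u (y * y))"
    using cond_pos[of y] by (simp add: ay phi_mult_B yB py cnonneg_def)
  \<comment> \<open>\<open>x * y\<close> is \<open>phi\<close>-null because
    \<open>phi y = 0\<close>; invariance of \<open>u\<close> and the module property of
    \<open>R\<close> then pass from \<open>adj x * x\<close> to \<open>w\<close>.\<close>
  have "adj (x * y) * (x * y) = (y * (adj x * x)) * y" by (simp add: adj_mult ay mult.assoc)
  then have "0 \<le> Re (u ((y * (adj x * x)) * y))"
    using cond_pos[of "x * y"] by (simp add: phi_mult_B yB py cnonneg_def)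
  also have "u ((y * (adj x * x)) * y) = u (R ((y * (adj x * x)) * y))" by (simp add: uR)
  also have "R ((y * (adj x * x)) * y) = l *\<^sub>R (y * w * y)"
    using yB by (simp add: B_def R_mult_right R_mult_left Rw)
  finally have n2: "0 \<le> Re (u (y * w * y))" using l by (simp add: us zero_le_mult_iff)
  \<comment> \<open>The Cayley relation \<open>y (1 + w) = w - 1\<close>.\<close>
  have yw: "y * w + y = w - 1" by (simp add: y_def algebra_simps vw)
  have "y * w * y + y * y = (y * w + y) * y" by (simp add: algebra_simps)
  also have "\<dots> = w - 1 - (y + y)" unfolding yw by (simp add: y_def algebra_simps wv)
  finally have "w - 1 = y * w * y + y * y + (y + y)" by simp
  then have eq: "u (w - 1) = u (y * w * y) + u (y * y) + (u y + u y)" by (simp only: us)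
  have "- (3 * K) \<le> Re (u y)"
  proof -
    have "0 \<le> K" using K[of 1] by (simp add: order_trans[OF norm_ge_zero])
    then have "cmod (u y) \<le> K * 3" using K[of y] mult_left_mono[OF ny] by (meson order_trans)
    then show ?thesis using abs_Re_le_cmod[of "u y"] by linarith
  qed
  then have "- (6 * K) \<le> Re (u (w - 1))" using n1 n2 by (simp add: eq)
  moreover have "u w = u (w - 1)" by (simp add: us u1)
  \<comment> \<open>\<open>w - 1\<close> is selfadjoint in \<open>B\<close> with
    \<open>phi (w - 1) = 0\<close>.\<close>
  moreover have "Im (u (w - 1)) = 0"
    by (intro conditionally_positive_real subspace_diff[OF B_subspace] wB B_1)
      (simp_all add: adj_diff aw ps pw phi_1)
  moreover have "u (adj x * x) = of_real l * u w"
    using uR[of "adj x * x"] by (simp add: Rw us)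
  ultimately show ?thesis
    using l mult_left_mono[of "- (6 * K)" "Re (u (w - 1))" l] by (simp add: mult.commute)
qed

end

end

section \<open>The equivalence, via the lower bound of \<open>u\<close> by a multiple of
  \<open>phi\<close>\<close>

theorem theorem3p1:
  fixes T :: "'a::cstar \<Rightarrow> 'a \<Rightarrow> 'b::cstar" and Delta :: "'a \<Rightarrow> 'b"
    and m1 :: "'b \<Rightarrow> 'a \<Rightarrow> 'c::cstar" and m2 :: "'a \<Rightarrow> 'b \<Rightarrow> 'c"
    and phi u :: "'a \<Rightarrow> complex"
  assumes "compact_quantum_group T Delta m1 m2"
    and "state phi" and "conv T Delta phi phi = phi"
    and "cfunctional u" and "conv T Delta u phi = u" and "conv T Delta phi u = u"
  shows "(u 1 = 0 \<and> (\<forall>x. phi (adj x * x) = 0 \<longrightarrow> cnonneg (u (adj x * x))))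
     \<longleftrightarrow> (\<exists>r::real. \<exists>v. 0 \<le> r \<and> state v \<and> conv T Delta v phi = v \<and> conv T Delta phi v = v
            \<and> u = (\<lambda>a. complex_of_real r * (v a - phi a)))"
proof
  assume "\<exists>r::real. \<exists>v. 0 \<le> r \<and> state v \<and> conv T Delta v phi = v \<and> conv T Delta phi v = v
            \<and> u = (\<lambda>a. complex_of_real r * (v a - phi a))"
  \<comment> \<open>On \<open>phi\<close>-null squares only \<open>r v\<close> survives, and
    \<open>u 1 = 0\<close> as both states are normalised.\<close>
  then show "u 1 = 0 \<and> (\<forall>x. phi (adj x * x) = 0 \<longrightarrow> cnonneg (u (adj x * x)))"
    using assms(2) by (auto simp: state_def intro: cnonneg_scale)
next
  assume "u 1 = 0 \<and> (\<forall>x. phi (adj x * x) = 0 \<longrightarrow> cnonneg (u (adj x * x)))"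
  then have u1: "u 1 = 0" and cond: "\<And>x. phi (adj x * x) = 0 \<Longrightarrow> cnonneg (u (adj x * x))" by auto
  interpret idempotent_state T Delta m1 m2 phi
    using assms(1-3) by unfold_locales
  obtain S where S: "bounded_linear S" "\<And>a b. S (T a b) = ofc (phi b) * a"
      "\<And>f h t. cfunctional f \<Longrightarrow> prodfun T f phi h \<Longrightarrow> h t = f (S t)"
    using slice_exists[OF mt phi_c] by blast
  interpret idempotent_state_slice T Delta m1 m2 phi S
    by (intro idempotent_state_slice.intro idempotent_state_slice_axioms.intro
        idempotent_state_axioms S)
  note u = assms(4)
  obtain K where K: "0 \<le> K" "\<And>a. cmod (u a) \<le> K * norm a"
    using bounded_linear.nonneg_bounded[OF cfunctional_bounded_linear[OF u]]
    by (auto simp: mult.commute)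
  have uR: "u (R a) = u a" for a using conv_phi[OF u, of a] assms(5) by simp
  note bound = conditionally_positive_bound[OF u cond u1 uR K(2)]
  \<comment> \<open>\<open>6 * K\<close> is the constant of \<open>bound\<close>; adding 1 permits
    division by \<open>r\<close> when \<open>K = 0\<close>.\<close>
  define r where "r = 6 * K + 1"
  have r: "0 < r" using K(1) by (simp add: r_def)
  define v where "v = (\<lambda>a. of_real (1 / r) * u a + 1 * phi a)"
  have "cfunctional v" unfolding v_def by (rule cfunctional_lincomb[OF u phi_c])
  moreover have "cnonneg (v (adj x * x))" for x
  proof -
    have p: "Im (phi (adj x * x)) = 0" "0 \<le> Re (phi (adj x * x))"
      using posf_nn[OF phi_pos, of x] by (auto simp: cnonneg_def)
    then have "- r * Re (phi (adj x * x)) \<le> Re (u (adj x * x))"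
      using bound[of x] by (simp add: r_def algebra_simps)
    then show ?thesis using bound[of x] p r by (simp add: v_def cnonneg_def field_simps)
  qed
  ultimately have "state v" using u1 phi_1 by (simp add: state_def v_def)
  moreover have "conv T Delta v phi = v"
    unfolding v_def by (intro ext) (simp only: conv_lincomb_left[OF u phi_c phi_c] assms(3,5))
  moreover have "conv T Delta phi v = v"
    unfolding v_def by (intro ext) (simp only: conv_lincomb_right[OF phi_c u phi_c] assms(3,6))
  moreover have "u = (\<lambda>a. complex_of_real r * (v a - phi a))"
    using r by (simp add: v_def)
  ultimately show "\<exists>r::real. \<exists>v. 0 \<le> r \<and> state v \<and> conv T Delta v phi = v \<and> conv T Delta phi v = v
            \<and> u = (\<lambda>a. complex_of_real r * (v a - phi a))"
    using r less_imp_le by blast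
qed

end
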